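(* Let $K$ be a finite connected abstract simplicial complex with a fixed linear order on its vertices, and let $v_0$ be a vertex of $K$. Let $1_K\colon K\to K$ be the identity map, let $\ast\colon K\to K$ be the constant map at the vertex $v_0$, let $\iota_1,\iota_2\colon K\to K\times K$ be the axial inclusions $\iota_1(v)=(v,v_0)$ and $\iota_2(v)=(v_0,v)$, and let $\pi_1,\pi_2\colon K\times K\to K$ be the two simplicial projections, where $K\times K$ is the ordered product. Then, in terms of the contiguity distance $\mathrm{D}$ of simplicial maps, $$\mathrm{cat}(\|K\|)=\mathrm{D}(\ast,1_K)=\mathrm{D}(\iota_1,\iota_2)\qquad\text{and}\qquad\mathrm{TC}(\|K\|)=\mathrm{D}(\pi_1,\pi_2).$$
   Context: Complexes are finite, connected abstract simplicial complexes (subcomplexes are not required to be connected). $\|K\|$ denotes the geometric realization of $K$ and $\|\varphi\|$ that of a simplicial map $\varphi$. $\mathrm{Sd}^b(L)$ is the $b$-fold iterated barycentric subdivision of $L$ ($\mathrm{Sd}^0(L)=L$), and $\|\mathrm{Sd}^b(L)\|$ is identified with $\|L\|$ in the standard way. Ordered product: $K\times K$ has vertex set $V_K\times V_K$, and its simplices are the sets $\{(v_0,w_0),\dots,(v_k,w_k)\}$ with $v_0\le\cdots\le v_k$, $w_0\le\cdots\le w_k$, and both $\{v_0,\dots,v_k\}$ and $\{w_0,\dots,w_k\}$ simplices of $K$; its realization is homeomorphic to $\|K\|\times\|K\|$. $\mathrm{cat}(X)$ is the (reduced) Lusternik-Schnirelmann category: one less than the smallest cardinality of open covers of $X$ by sets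 whose inclusion into $X$ is null-homotopic. $\mathrm{TC}(X)$ is Farber's (reduced) topological complexity: one less than the smallest cardinality of open covers $\{U_i\}$ of $X\times X$ such that the end-point evaluation map $e\colon P(X)\to X\times X$, $e(\gamma)=(\gamma(0),\gamma(1))$, defined on the space $P(X)$ of free paths in $X$, admits a continuous section on each $U_i$. Contiguity: simplicial maps $\varphi,\varphi'\colon J\to K$ are $1$-contiguous if $\varphi(\sigma)\cup\varphi'(\sigma)$ is a simplex of $K$ for every facet (maximal simplex) $\sigma$ of $J$. For a positive integer $c$ they are $c$-contiguous if there are simplicial maps $\varphi=\varphi_0,\varphi_1,\dots,\varphi_c=\varphi'\colon J\to K$ with $\varphi_{i-1}$ and $\varphi_i$ $1$-contiguous for each $1\le i\le c$. Simplicial approximation: for a simplex $\sigma$ of $K$, $\langle\sigma\rangle\subseteq\|K\|$ is the open realized simplex (barycentric combinations of the vertices of $\sigma$ with all coefficients positive) and $\|\sigma\|$ is its closure. A simplicial map $\varphi\colon J\to K$ is a simplicial approximation of a continuous map $f\colon\|J\|\to\|K\|$ if $\|\varphi\|(x)\in\|\sigma\|$ whenever $f(x)\in\langle\sigma\rangle$. Strict contiguity distance: for simplicial maps $\varphi,\varphi'\colon L\to K$, $\mathrm{SD}_c(\varphi,\varphi')$ is one less than the smallest cardinality of finite covers of $L$ by subcomplexes $J$ for which $\varphi_{|J}$ and $\varphi'_{|J}$ are $c$-contiguous, and $\mathrm{SD}(\varphi,\varphi')=\lim_{c\to\infty}\mathrm{SD}_c(\varphi,\varphi')$, the eventual constant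 value of the non-increasing sequence $\mathrm{SD}_1\ge\mathrm{SD}_2\ge\cdots$. Contiguity distance: for each $b\ge1$ fix a simplicial approximation $\lambda_b\colon\mathrm{Sd}^b(L)\to\mathrm{Sd}^{b-1}(L)$ of the identity on $\|L\|$. Put $\varphi_b=\varphi\circ\lambda_1\circ\cdots\circ\lambda_b$ and $\varphi'_b=\varphi'\circ\lambda_1\circ\cdots\circ\lambda_b$, as maps $\mathrm{Sd}^b(L)\to K$ (with $\varphi_0=\varphi$, $\varphi'_0=\varphi'$), and $\mathrm{SD}^b(\varphi,\varphi')=\mathrm{SD}(\varphi_b,\varphi'_b)$. This number does not depend on the chosen approximations $\lambda_b$, and $\mathrm{SD}^0\ge\mathrm{SD}^1\ge\mathrm{SD}^2\ge\cdots\ge0$. The contiguity distance is $\mathrm{D}(\varphi,\varphi')=\lim_{b\to\infty}\mathrm{SD}^b(\varphi,\varphi')$, the eventual constant value of this sequence. *)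

theory Defs
  imports "HOL-Analysis.Analysis" "HOL-Library.FSet"
begin

section \<open>Abstract simplicial complexes\<close>

text \<open>A complex is its set of (nonempty, finite) simplices; its vertex set is \<^term>\<open>\<Union>K\<close>.\<close>

definition abstract_complex :: "'a set set \<Rightarrow> bool" where
  "abstract_complex K \<longleftrightarrow>
     (\<forall>\<sigma>\<in>K. finite \<sigma> \<and> \<sigma> \<noteq> {} \<and> (\<forall>\<tau>. \<tau> \<noteq> {} \<longrightarrow> \<tau> \<subseteq> \<sigma> \<longrightarrow> \<tau> \<in> K))"

definition connected_complex :: "'a set set \<Rightarrow> bool" where
  "connected_complex K \<longleftrightarrow>
     K \<noteq> {} \<and> (\<forall>v\<in>\<Union>K. \<forall>w\<in>\<Union>K. (v, w) \<in> {(a, b). {a, b} \<in> K}\<^sup>*)"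

definition subcomplex :: "'a set set \<Rightarrow> 'a set set \<Rightarrow> bool" where
  "subcomplex J L \<longleftrightarrow> abstract_complex J \<and> J \<subseteq> L"

definition facets :: "'a set set \<Rightarrow> 'a set set" where
  "facets J = {\<sigma> \<in> J. \<forall>\<tau>\<in>J. \<sigma> \<subseteq> \<tau> \<longrightarrow> \<tau> = \<sigma>}"

definition simplicial_map :: "'a set set \<Rightarrow> 'b set set \<Rightarrow> ('a \<Rightarrow> 'b) \<Rightarrow> bool" where
  "simplicial_map J K \<phi> \<longleftrightarrow> (\<forall>\<sigma>\<in>J. \<phi> ` \<sigma> \<in> K)"

definition ordered_square :: "'a rel \<Rightarrow> 'a set set \<Rightarrow> ('a \<times> 'a) set set" where
  "ordered_square r K =
     {set ps | ps. ps \<noteq> [] \<and>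
        sorted_wrt (\<lambda>v v'. (v, v') \<in> r) (map fst ps) \<and>
        sorted_wrt (\<lambda>w w'. (w, w') \<in> r) (map snd ps) \<and>
        set (map fst ps) \<in> K \<and> set (map snd ps) \<in> K}"


section \<open>Geometric realization\<close>

text \<open>A point of the realization is given by its barycentric coordinates. Only finite complexes
  are considered, for which the topology of pointwise convergence of coordinates is the usual one.\<close>

definition support :: "('a \<Rightarrow> real) \<Rightarrow> 'a set" where
  "support x = {v. x v \<noteq> 0}"

definition realization :: "'a set set \<Rightarrow> ('a \<Rightarrow> real) topology" where
  "realization K = subtopology (powertop_real UNIV)
     {x. (\<forall>v. 0 \<le> x v) \<and> support x \<in> K \<and> (\<Sum>v\<in>support x. x v) = 1}"

definition realization_map :: "('a \<Rightarrow> 'b) \<Rightarrow> ('a \<Rightarrow> real) \<Rightarrow> ('b \<Rightarrow> real)" where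
  "realization_map \<phi> x = (\<lambda>w. \<Sum>v | v \<in> support x \<and> \<phi> v = w. x v)"

definition open_simplex :: "'a set set \<Rightarrow> 'a set \<Rightarrow> ('a \<Rightarrow> real) set" where
  "open_simplex K \<sigma> = {x \<in> topspace (realization K). support x = \<sigma>}"

definition closed_simplex :: "'a set set \<Rightarrow> 'a set \<Rightarrow> ('a \<Rightarrow> real) set" where
  "closed_simplex K \<sigma> = realization K closure_of open_simplex K \<sigma>"

definition simplicial_approximation ::
  "'a set set \<Rightarrow> 'b set set \<Rightarrow> (('a \<Rightarrow> real) \<Rightarrow> ('b \<Rightarrow> real)) \<Rightarrow> ('a \<Rightarrow> 'b) \<Rightarrow> bool" where
  "simplicial_approximation J K f \<phi> \<longleftrightarrow> simplicial_map J K \<phi> \<and>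
     (\<forall>\<sigma>\<in>K. \<forall>x \<in> topspace (realization J).
        f x \<in> open_simplex K \<sigma> \<longrightarrow> realization_map \<phi> x \<in> closed_simplex K \<sigma>)"


section \<open>Iterated barycentric subdivision\<close>

text \<open>All iterated subdivisions of a complex with vertices in \<^typ>\<open>'a\<close> have their vertices in the
  following type: either an original vertex, or the barycentre of a simplex of the preceding
  subdivision.\<close>

datatype 'a sd_vertex = Vert (base_vertex: 'a) | Bary "'a sd_vertex fset"

definition barycentric_subdivision :: "'a sd_vertex set set \<Rightarrow> 'a sd_vertex set set" where
  "barycentric_subdivision M =
     {Bary ` C | C. C \<noteq> {} \<and> finite C \<and> subset.chain M (fset ` C)}"

text \<open>\<open>Sd 0 L\<close> is \<open>L\<close> itself, with each vertex \<open>v\<close> renamed to \<open>Vert v\<close>.\<close>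

definition Sd :: "nat \<Rightarrow> 'a set set \<Rightarrow> 'a sd_vertex set set" where
  "Sd b L = (barycentric_subdivision ^^ b) ((`) Vert ` L)"

text \<open>The standard identification of the realization of the barycentric subdivision of a complex
  with the realization of that complex: it is affine on simplices and sends the vertex
  \<open>Bary F\<close> to the barycentre of the simplex \<open>F\<close>.\<close>

definition sd_identification ::
  "('a sd_vertex \<Rightarrow> real) \<Rightarrow> ('a sd_vertex \<Rightarrow> real)" where
  "sd_identification x =
     (\<lambda>v. \<Sum>F | Bary F \<in> support x \<and> v |\<in>| F. x (Bary F) / real (fcard F))"

text \<open>Under these identifications, the identity of the realization of \<open>L\<close> is
  \<^const>\<open>sd_identification\<close> as a map from the realization of \<open>Sd b L\<close> to that of \<open>Sd (b - 1) L\<close>.\<close>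

definition identity_approximations ::
  "'a set set \<Rightarrow> (nat \<Rightarrow> 'a sd_vertex \<Rightarrow> 'a sd_vertex) \<Rightarrow> bool" where
  "identity_approximations L lam \<longleftrightarrow>
     (\<forall>b\<ge>1. simplicial_approximation (Sd b L) (Sd (b - 1) L) sd_identification (lam b))"


section \<open>Contiguity distance\<close>

definition contiguous1 :: "'a set set \<Rightarrow> 'b set set \<Rightarrow> ('a \<Rightarrow> 'b) \<Rightarrow> ('a \<Rightarrow> 'b) \<Rightarrow> bool" where
  "contiguous1 J K \<phi> \<phi>' \<longleftrightarrow> (\<forall>\<sigma> \<in> facets J. \<phi> ` \<sigma> \<union> \<phi>' ` \<sigma> \<in> K)"

definition contiguous ::
  "nat \<Rightarrow> 'a set set \<Rightarrow> 'b set set \<Rightarrow> ('a \<Rightarrow> 'b) \<Rightarrow> ('a \<Rightarrow> 'b) \<Rightarrow> bool" where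
  "contiguous c J K \<phi> \<phi>' \<longleftrightarrow>
     (\<exists>\<psi>. (\<forall>v\<in>\<Union>J. \<psi> 0 v = \<phi> v) \<and> (\<forall>v\<in>\<Union>J. \<psi> c v = \<phi>' v) \<and>
        (\<forall>i\<le>c. simplicial_map J K (\<psi> i)) \<and>
        (\<forall>i\<in>{1..c}. contiguous1 J K (\<psi> (i - 1)) (\<psi> i)))"

text \<open>The value is \<open>\<infinity>\<close> if there is no cover of the required kind, which can happen for small \<open>c\<close>.\<close>

definition strict_contiguity_distance_at ::
  "nat \<Rightarrow> 'a set set \<Rightarrow> 'b set set \<Rightarrow> ('a \<Rightarrow> 'b) \<Rightarrow> ('a \<Rightarrow> 'b) \<Rightarrow> enat" where
  "strict_contiguity_distance_at c L K \<phi> \<phi>' =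
     Inf {enat (card \<J>) | \<J>. finite \<J> \<and> \<Union>\<J> = L \<and>
        (\<forall>J\<in>\<J>. subcomplex J L \<and> contiguous c J K \<phi> \<phi>')} - 1"

text \<open>In the order topology of \<^typ>\<open>enat\<close>, the limit of a non-increasing sequence is its eventual
  constant value.\<close>

definition strict_contiguity_distance ::
  "'a set set \<Rightarrow> 'b set set \<Rightarrow> ('a \<Rightarrow> 'b) \<Rightarrow> ('a \<Rightarrow> 'b) \<Rightarrow> enat" where
  "strict_contiguity_distance L K \<phi> \<phi>' =
     lim (\<lambda>c. strict_contiguity_distance_at c L K \<phi> \<phi>')"

primrec subdivided_map ::
  "(nat \<Rightarrow> 'a sd_vertex \<Rightarrow> 'a sd_vertex) \<Rightarrow> ('a \<Rightarrow> 'b) \<Rightarrow> nat \<Rightarrow> 'a sd_vertex \<Rightarrow> 'b" where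
  "subdivided_map lam \<phi> 0 = \<phi> \<circ> base_vertex"
| "subdivided_map lam \<phi> (Suc b) = subdivided_map lam \<phi> b \<circ> lam (Suc b)"

text \<open>The choice \<open>lam\<close> of approximations of the identity is an explicit parameter; it is meant to
  satisfy \<^term>\<open>identity_approximations L lam\<close>.\<close>

definition contiguity_distance ::
  "(nat \<Rightarrow> 'a sd_vertex \<Rightarrow> 'a sd_vertex) \<Rightarrow>
     'a set set \<Rightarrow> 'b set set \<Rightarrow> ('a \<Rightarrow> 'b) \<Rightarrow> ('a \<Rightarrow> 'b) \<Rightarrow> enat" where
  "contiguity_distance lam L K \<phi> \<phi>' =
     lim (\<lambda>b. strict_contiguity_distance (Sd b L) K
                (subdivided_map lam \<phi> b) (subdivided_map lam \<phi>' b))"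


section \<open>Lusternik-Schnirelmann category and topological complexity\<close>

definition null_homotopic_in :: "'a topology \<Rightarrow> 'a set \<Rightarrow> bool" where
  "null_homotopic_in X U \<longleftrightarrow>
     (\<exists>a \<in> topspace X. homotopic_with (\<lambda>_. True) (subtopology X U) X id (\<lambda>_. a))"

definition LS_category :: "'a topology \<Rightarrow> enat" where
  "LS_category X =
     Inf {enat (card \<U>) | \<U>. finite \<U> \<and> \<Union>\<U> = topspace X \<and>
        (\<forall>U\<in>\<U>. openin X U \<and> null_homotopic_in X U)} - 1"

text \<open>The space of free paths, with the compact-open topology. Paths are normalized outside of
  the unit interval, so that each path is represented by exactly one function.\<close>

definition path_space :: "'a topology \<Rightarrow> (real \<Rightarrow> 'a) topology" where
  "path_space X = topology_generated_by
     {{\<gamma> \<in> extensional {0..1}. pathin X \<gamma> \<and> \<gamma> ` C \<subseteq> U} | C U.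
        compact C \<and> C \<subseteq> {0..1} \<and> openin X U}"

definition endpoints :: "(real \<Rightarrow> 'a) \<Rightarrow> 'a \<times> 'a" where
  "endpoints \<gamma> = (\<gamma> 0, \<gamma> 1)"

definition topological_complexity :: "'a topology \<Rightarrow> enat" where
  "topological_complexity X =
     Inf {enat (card \<U>) | \<U>. finite \<U> \<and> \<Union>\<U> = topspace (prod_topology X X) \<and>
        (\<forall>U\<in>\<U>. openin (prod_topology X X) U \<and>
           (\<exists>s. continuous_map (subtopology (prod_topology X X) U) (path_space X) s \<and>
                (\<forall>p\<in>U. endpoints (s p) = p)))} - 1"


section \<open>Existence of approximations of the identity\<close>

text \<open>Any choice, for each simplex, of one of its vertices gives an approximation of the identity,
  so \<^const>\<open>identity_approximations\<close> is satisfiable for every complex.\<close>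

lemma abstract_complex_ordered_square:
  assumes "abstract_complex K"
  shows "abstract_complex (ordered_square r K)"
  unfolding abstract_complex_def
proof (intro ballI conjI allI impI)
  fix \<sigma> assume "\<sigma> \<in> ordered_square r K"
  then obtain ps where ps: "\<sigma> = set ps" "ps \<noteq> []"
      "sorted_wrt (\<lambda>v v'. (v, v') \<in> r) (map fst ps)"
      "sorted_wrt (\<lambda>w w'. (w, w') \<in> r) (map snd ps)"
      "set (map fst ps) \<in> K" "set (map snd ps) \<in> K"
    unfolding ordered_square_def by blast
  show "finite \<sigma>" "\<sigma> \<noteq> {}" using ps(1,2) by simp_all
  fix \<tau> assume t: "\<tau> \<noteq> {}" "\<tau> \<subseteq> \<sigma>"
  define qs where "qs = filter (\<lambda>p. p \<in> \<tau>) ps"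
  have qs: "set qs = \<tau>" using t(2) ps(1) by (auto simp: qs_def)
  then have "qs \<noteq> []" using t(1) by auto
  have face: "f ` \<tau> \<in> K" if "f ` set ps \<in> K" for f :: "'a \<times> 'a \<Rightarrow> 'a"
    using assms that image_mono[OF t(2), of f] t(1) ps(1)
    unfolding abstract_complex_def by (metis image_is_empty)
  show "\<tau> \<in> ordered_square r K"
    unfolding ordered_square_def
  proof (intro CollectI exI[of _ qs] conjI)
    show "\<tau> = set qs" using qs by simp
    show "sorted_wrt (\<lambda>v v'. (v, v') \<in> r) (map fst qs)"
      "sorted_wrt (\<lambda>w w'. (w, w') \<in> r) (map snd qs)"
      using ps(3,4) by (simp_all add: qs_def sorted_wrt_map sorted_wrt_filter)
    show "set (map fst qs) \<in> K" "set (map snd qs) \<in> K"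
      using face ps(5,6) qs by simp_all
  qed (fact \<open>qs \<noteq> []\<close>)
qed

lemma realization_iff:
  "x \<in> topspace (realization K) \<longleftrightarrow> (\<forall>v. 0 \<le> x v) \<and> support x \<in> K \<and> (\<Sum>v\<in>support x. x v) = 1"
  by (simp add: realization_def)

lemma fset_chain_max:
  assumes "finite C" "C \<noteq> {}" "subset.chain M (fset ` C)"
  shows "\<exists>F\<in>C. fset F \<in> M \<and> (\<forall>G\<in>C. fset G \<subseteq> fset F)"
proof -
  have "\<Union>(fset ` C) \<in> fset ` C"
    using assms by (intro Union_in_chain) auto
  then obtain F where F: "F \<in> C" "\<Union>(fset ` C) = fset F" by auto
  moreover have "fset F \<in> M" using assms(3) F(1) unfolding subset_chain_def by auto
  ultimately show ?thesis by (metis UN_upper)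
qed

lemma abstract_complex_barycentric_subdivision:
  "abstract_complex (barycentric_subdivision M)"
  unfolding abstract_complex_def
proof (intro ballI conjI allI impI)
  fix \<sigma> assume "\<sigma> \<in> barycentric_subdivision M"
  then obtain C where C: "\<sigma> = Bary ` C" "C \<noteq> {}" "finite C" "subset.chain M (fset ` C)"
    by (auto simp: barycentric_subdivision_def)
  show "finite \<sigma>" "\<sigma> \<noteq> {}" using C by auto
  fix \<tau> assume t: "\<tau> \<noteq> {}" "\<tau> \<subseteq> \<sigma>"
  then obtain C' where C': "C' \<subseteq> C" "\<tau> = Bary ` C'" using C(1) by (metis subset_imageE)
  have "subset.chain M (fset ` C')"
    unfolding subset_chain_def
  proof (intro conjI ballI)
    have im: "fset ` C' \<subseteq> fset ` C" by (rule image_mono) (rule C'(1))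
    then show "fset ` C' \<subseteq> M" using C(4) unfolding subset_chain_def by (metis order_trans)
    fix X Y assume "X \<in> fset ` C'" "Y \<in> fset ` C'"
    then have "X \<in> fset ` C" "Y \<in> fset ` C" using im by (metis subsetD)+
    then show "X \<subseteq> Y \<or> Y \<subseteq> X" using C(4) unfolding subset_chain_def by metis
  qed
  moreover have "C' \<noteq> {}" "finite C'" using C' t(1) finite_subset[OF C'(1) C(3)] by simp_all
  ultimately show "\<tau> \<in> barycentric_subdivision M"
    unfolding barycentric_subdivision_def C'(2) by (intro CollectI exI[of _ C']) simp
qed

lemma abstract_complex_Sd: "abstract_complex L \<Longrightarrow> abstract_complex (Sd b L)"
proof (cases b)
  case 0
  assume L: "abstract_complex L"
  show ?thesis unfolding abstract_complex_def
  proof (intro ballI conjI allI impI)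
    fix \<sigma> assume "\<sigma> \<in> Sd b L"
    then obtain s where s: "\<sigma> = Vert ` s" "s \<in> L" by (auto simp: Sd_def 0)
    have "finite s" "s \<noteq> {}" using s(2) L unfolding abstract_complex_def by metis+
    then show "finite \<sigma>" "\<sigma> \<noteq> {}" unfolding s(1) by simp_all
    fix \<tau> assume t: "\<tau> \<noteq> {}" "\<tau> \<subseteq> \<sigma>"
    then obtain s' where "s' \<subseteq> s" "\<tau> = Vert ` s'" using s(1) by (metis subset_imageE)
    moreover from this have "s' \<in> L"
      using t(1) L s(2) unfolding abstract_complex_def by (metis image_empty)
    ultimately show "\<tau> \<in> Sd b L" by (simp add: Sd_def 0)
  qed
qed (simp add: Sd_def abstract_complex_barycentric_subdivision)

lemma closed_simplexI:
  assumes K: "abstract_complex K" and y: "y \<in> topspace (realization K)" "support y \<subseteq> \<sigma>"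
    and z: "z \<in> open_simplex K \<sigma>"
  shows "y \<in> closed_simplex K \<sigma>"
proof -
  define g where "g t = (\<lambda>v. (1-t) * y v + t * z v)" for t :: real
  have zz: "z \<in> topspace (realization K)" "support z = \<sigma>" "\<sigma> \<in> K"
    using z by (auto simp: open_simplex_def realization_iff)
  have fin: "finite \<sigma>" using K zz(3) unfolding abstract_complex_def by metis
  have nn: "0 \<le> y v" "0 \<le> z v" for v using y zz by (auto simp: realization_iff)
  have sy: "sum y \<sigma> = 1"
    using y(1) sum.mono_neutral_left[OF fin y(2), of y] by (auto simp: realization_iff support_def)
  have sz: "sum z \<sigma> = 1" using zz by (auto simp: realization_iff)
  have supp: "support (g t) = \<sigma>" if "0 < t" "t \<le> 1" for t
  proof -
    have "g t v \<noteq> 0 \<longleftrightarrow> z v \<noteq> 0" for v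
    proof -
      have a: "0 \<le> (1-t) * y v" using that nn by simp
      show ?thesis
      proof (cases "z v = 0")
        case True
        then have "v \<notin> \<sigma>" using zz(2) by (auto simp: support_def)
        then have "y v = 0" using y(2) by (auto simp: support_def)
        then show ?thesis using True by (simp add: g_def)
      next
        case False
        then have "0 < t * z v" using that nn(2)[of v] by simp
        then show ?thesis using a False unfolding g_def by linarith
      qed
    qed
    then show ?thesis using zz(2) by (auto simp: support_def)
  qed
  have sum: "sum (g t) \<sigma> = 1" for t
    unfolding g_def by (simp add: sum.distrib sum_distrib_left[symmetric] sy sz)
  have op: "g t \<in> open_simplex K \<sigma>" if "0 < t" "t \<le> 1" for t
    unfolding open_simplex_def using supp[OF that] sum[of t] zz(3) that nn
    by (auto simp: realization_iff g_def)
  have g0: "g 0 = y" by (simp add: g_def)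
  have cont: "continuous_map (top_of_set {0..1}) (realization K) g"
    unfolding realization_def continuous_map_in_subtopology
  proof (intro conjI)
    show "continuous_map (top_of_set {0..1}) (powertop_real UNIV) g"
      unfolding continuous_map_componentwise_UNIV g_def
      by (auto intro!: continuous_intros)
    show "g \<in> topspace (top_of_set {0..1}) \<rightarrow> {x. (\<forall>v. 0 \<le> x v) \<and> support x \<in> K \<and> sum x (support x) = 1}"
    proof
      fix t assume "t \<in> topspace (top_of_set {0..1::real})"
      then have t: "0 \<le> t" "t \<le> 1" by auto
      show "g t \<in> {x. (\<forall>v. 0 \<le> x v) \<and> support x \<in> K \<and> sum x (support x) = 1}"
      proof (cases "t = 0")
        case True then show ?thesis using y(1) g0 by (auto simp: realization_iff)
      next
        case False then show ?thesis using op[of t] t by (auto simp: open_simplex_def realization_iff)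
      qed
    qed
  qed
  have "(0::real) \<in> top_of_set {0..1} closure_of {0<..1}"
  proof -
    have "{0..1} \<inter> {0<..1::real} = {0<..1}" by auto
    then show ?thesis by (simp add: closure_of_subtopology)
  qed
  then have "g 0 \<in> realization K closure_of g ` {0<..1}"
    using continuous_map_image_closure_subset[OF cont] by blast
  moreover have "g ` {0<..1} \<subseteq> open_simplex K \<sigma>" using op by auto
  ultimately show ?thesis unfolding closed_simplex_def g0 using closure_of_mono by blast
qed

lemma identity_approximations_exist:
  assumes "abstract_complex L"
  shows "\<exists>lam. identity_approximations L lam"
proof -
  define p :: "'a sd_vertex \<Rightarrow> 'a sd_vertex"
    where "p v = (case v of Bary F \<Rightarrow> (SOME w. w |\<in>| F) | _ \<Rightarrow> v)" for v
  have p: "p (Bary F) |\<in>| F" if "fset F \<noteq> {}" for F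
    using that unfolding p_def by (auto intro: someI_ex)
  have "simplicial_approximation (barycentric_subdivision M) M sd_identification p"
    if M: "abstract_complex M" for M :: "'a sd_vertex set set"
    unfolding simplicial_approximation_def
  proof (intro conjI ballI impI)
    have pim: "p ` \<sigma> \<in> M" if "\<sigma> \<in> barycentric_subdivision M" for \<sigma>
    proof -
      obtain C where C: "\<sigma> = Bary ` C" "C \<noteq> {}" "finite C" "subset.chain M (fset ` C)"
        using \<open>\<sigma> \<in> _\<close> by (auto simp: barycentric_subdivision_def)
      obtain F where F: "F \<in> C" "fset F \<in> M" "\<forall>G\<in>C. fset G \<subseteq> fset F"
        using fset_chain_max[OF C(3,2,4)] by blast
      have ne: "fset G \<noteq> {}" if "G \<in> C" for G
        using C(4) M that by (metis abstract_complex_def image_subset_iff subset_chain_def)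
      have "p (Bary G) \<in> fset F" if "G \<in> C" for G
        using p[OF ne[OF that]] F(3) that by (metis subsetD)
      then have "p ` \<sigma> \<subseteq> fset F" unfolding C(1) by (simp add: image_subset_iff)
      moreover have "p ` \<sigma> \<noteq> {}" using C(1,2) by simp
      ultimately show ?thesis using F(2) M unfolding abstract_complex_def by metis
    qed
    then show "simplicial_map (barycentric_subdivision M) M p"
      by (simp add: simplicial_map_def)
    fix \<sigma> x assume "\<sigma> \<in> M" and x: "x \<in> topspace (realization (barycentric_subdivision M))"
      and z: "sd_identification x \<in> open_simplex M \<sigma>"
    have xx: "\<And>v. 0 \<le> x v" "support x \<in> barycentric_subdivision M" "sum x (support x) = 1"
      using x by (auto simp: realization_iff)
    have fin: "finite (support x)" using xx(2) abstract_complex_barycentric_subdivision unfolding abstract_complex_def by metis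
    define y where "y = realization_map p x"
    have nn: "0 \<le> y w" for w unfolding y_def realization_map_def by (simp add: sum_nonneg xx)
    have ypos: "y w \<noteq> 0 \<longleftrightarrow> w \<in> p ` support x" for w
    proof -
      have "y w = 0 \<longleftrightarrow> (\<forall>v\<in>{v. v \<in> support x \<and> p v = w}. x v = 0)"
        unfolding y_def realization_map_def using fin by (intro sum_nonneg_eq_0_iff) (auto simp: xx)
      then show ?thesis by (auto simp: support_def)
    qed
    then have sy: "support y = p ` support x" by (auto simp: support_def)
    have "sum y (support y) = sum x (support x)"
      unfolding sy unfolding y_def realization_map_def using sum.image_gen[OF fin, of x p] by simp
    then have yM: "y \<in> topspace (realization M)"
      using nn pim[OF xx(2)] sy xx(3) by (simp add: realization_iff)
    have "support y \<subseteq> \<sigma>"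
    proof
      fix w assume "w \<in> support y"
      then obtain v where v: "v \<in> support x" "w = p v" using sy by auto
      obtain C where C: "support x = Bary ` C" "subset.chain M (fset ` C)"
        using xx(2) by (auto simp: barycentric_subdivision_def)
      then obtain F where F: "v = Bary F" "F \<in> C" using v by auto
      have ne: "fset F \<noteq> {}" using C(2) M F(2) by (metis abstract_complex_def image_subset_iff subset_chain_def)
      have wF: "w |\<in>| F" using p[OF ne] F v by simp
      have "finite {G. Bary G \<in> support x \<and> w |\<in>| G}"
        using fin C(1) by (auto intro!: finite_subset[OF _ finite_vimageI[OF fin, of Bary]] simp: inj_def)
      then have "x (Bary F) / real (fcard F) \<le> sd_identification x w"
        unfolding sd_identification_def using v F wF
        by (intro member_le_sum) (auto simp: xx)
      moreover have "0 < x (Bary F) / real (fcard F)"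
        using v(1) F(1) xx(1)[of v] ne by (auto simp: support_def fcard.rep_eq card_gt_0_iff)
      ultimately have "w \<in> support (sd_identification x)" by (auto simp: support_def)
      then show "w \<in> \<sigma>" using z by (simp add: open_simplex_def)
    qed
    then show "realization_map p x \<in> closed_simplex M \<sigma>"
      using closed_simplexI[OF M yM _ z] by (simp add: y_def)
  qed
  then have "simplicial_approximation (Sd b L) (Sd (b - 1) L) sd_identification p" if "b \<ge> 1" for b
    using abstract_complex_Sd[OF assms, of "b - 1"] that by (cases b) (auto simp: Sd_def)
  then show ?thesis unfolding identity_approximations_def by (intro exI[of _ "\<lambda>_. p"]) simp
qed

end

theory Submission
  imports Defs
begin

text \<open>All the numbers in question are homotopic distances: for continuous maps \<open>f\<close> and \<open>g\<close> on \<open>X\<close>, one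
  less than the smallest size of an open cover of \<open>X\<close> by sets on which \<open>f\<close> and \<open>g\<close> are homotopic.
  The heart is \<open>contiguity_distance_eq_homotopic_distance\<close>: the contiguity distance of two simplicial
  maps is the homotopic distance of their realizations.

  One inequality turns a cover of \<open>Sd b L\<close> by subcomplexes into an open cover of \<open>L\<close>
  (\<open>homotopic_on_open_set_if_contiguous\<close>). Contiguous maps have homotopic realizations because their
  values lie in common simplices, where straight lines join them. Every subcomplex has an open
  neighbourhood that is mapped to it without leaving the simplices of the points
  (\<open>open_thickening_exists\<close>), and \<open>L\<close> is mapped to its subdivisions in such a way that the
  approximations of the identity lead back into the simplex of the original point
  (\<open>map_to_iterated_subdivision_exists\<close>). Such maps may replace the homeomorphism between \<open>L\<close> and
  \<open>Sd b L\<close>, because straight lines repair the difference up to homotopy.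

  The other inequality is simplicial approximation in families
  (\<open>contiguous_cover_if_homotopic_cover\<close>). By compactness there is a radius such that each ball of this
  radius stays, during short time intervals, within the open star of one vertex under one of the
  given homotopies. Once the mesh of \<open>Sd b L\<close> is below this radius, choosing such stars for each
  vertex of \<open>Sd b L\<close> and each of finitely many times gives a chain of contiguous maps.

  What remains is topology. Null-homotopic inclusions are those homotopic to one fixed constant, as
  the realization is path connected; composition with the axial inclusions and with the second
  projection translates between the homotopies behind the first two distances; and a section of the
  end-point map is a homotopy between the two projections of the product \<open>X \<times> X\<close>. Finally \<open>X \<times> X\<close> is
  mapped to the realization of the ordered square by coupling two points like two probability
  distributions on an ordered set
  (\<open>map_to_ordered_square_exists\<close>).\<close>

abbreviation homotopic :: "'a topology \<Rightarrow> 'b topology \<Rightarrow> ('a \<Rightarrow> 'b) \<Rightarrow> ('a \<Rightarrow> 'b) \<Rightarrow> bool" where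
  "homotopic \<equiv> homotopic_with (\<lambda>_. True)"

section \<open>Maps into the realization of a complex\<close>

lemma complex_simplexD:
  assumes "abstract_complex K" "\<sigma> \<in> K"
  shows "finite \<sigma>" "\<sigma> \<noteq> {}" "\<tau> \<noteq> {} \<Longrightarrow> \<tau> \<subseteq> \<sigma> \<Longrightarrow> \<tau> \<in> K"
  using assms unfolding abstract_complex_def by metis+

lemma finite_vertices:
  assumes "abstract_complex K" "finite K"
  shows "finite (\<Union>K)"
  using assms complex_simplexD(1) by blast

lemma sum_over_support:
  assumes "finite S" "support x \<subseteq> S"
  shows "sum x S = sum x (support x)"
  using assms by (intro sum.mono_neutral_right) (auto simp: support_def)

lemma realization_memberI:
  assumes "\<And>v. 0 \<le> x v" "support x \<in> K" "finite S" "support x \<subseteq> S" "sum x S = 1"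
  shows "x \<in> topspace (realization K)"
  using assms sum_over_support[of S x] by (simp add: realization_iff)

lemma realization_memberD:
  assumes "x \<in> topspace (realization K)"
  shows "0 \<le> x v" "support x \<in> K" "finite S \<Longrightarrow> support x \<subseteq> S \<Longrightarrow> sum x S = 1"
  using assms sum_over_support[of S x] by (simp_all add: realization_iff)

lemma coordinate_pos_iff:
  assumes "x \<in> topspace (realization K)"
  shows "0 < x v \<longleftrightarrow> v \<in> support x"
  using realization_memberD(1)[OF assms, of v] by (auto simp: support_def)

lemma continuous_map_into_realization:
  "continuous_map X (realization K) f \<longleftrightarrow>
     (\<forall>v. continuous_map X euclideanreal (\<lambda>x. f x v)) \<and>
     (\<forall>x\<in>topspace X. f x \<in> topspace (realization K))"
  unfolding realization_def continuous_map_in_subtopology continuous_map_componentwise_UNIV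
  by (auto simp: realization_def)

lemma continuous_map_coordinate:
  "continuous_map X (realization K) f \<Longrightarrow> continuous_map X euclideanreal (\<lambda>x. f x v)"
  by (simp add: continuous_map_into_realization)

lemma continuous_map_realization_coordinate:
  "continuous_map (realization K) euclideanreal (\<lambda>x. x v)"
  using continuous_map_coordinate[of "realization K" K "\<lambda>x. x"] by simp

text \<open>Every map into a realization that is needed below is first written down with continuous
  nonnegative coordinates, arranged so that the set of positive ones is a simplex, and only then
  scaled to have coordinate sum one.\<close>

definition normalize_on :: "'b set \<Rightarrow> ('b \<Rightarrow> real) \<Rightarrow> 'b \<Rightarrow> real" where
  "normalize_on W g = (\<lambda>v. g v / sum g W)"

lemma
  assumes "finite W" "\<And>v. 0 \<le> g v" "support g \<subseteq> W" "support g \<noteq> {}"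
  shows sum_pos_of_support: "0 < sum g W"
    and support_normalize_on: "support (normalize_on W g) = support g"
proof -
  obtain v where v: "v \<in> support g" using assms(4) by blast
  then have "0 < g v" using assms(2)[of v] by (auto simp: support_def)
  then show pos: "0 < sum g W"
    using assms v by (intro sum_pos2[of W v]) auto
  then show "support (normalize_on W g) = support g"
    by (auto simp: support_def normalize_on_def)
qed

lemma continuous_map_normalize_on:
  assumes K: "abstract_complex K" and W: "finite W"
    and cont: "\<And>v. continuous_map X euclideanreal (\<lambda>x. f x v)"
    and nonneg: "\<And>x v. x \<in> topspace X \<Longrightarrow> 0 \<le> f x v"
    and supp: "\<And>x. x \<in> topspace X \<Longrightarrow> support (f x) \<subseteq> W"
      "\<And>x. x \<in> topspace X \<Longrightarrow> support (f x) \<in> K"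
  shows "continuous_map X (realization K) (\<lambda>x. normalize_on W (f x))"
  unfolding continuous_map_into_realization
proof (intro conjI allI ballI)
  have supp': "support (normalize_on W (f x)) = support (f x)" and pos: "0 < sum (f x) W"
    if "x \<in> topspace X" for x
    using complex_simplexD(2)[OF K supp(2)[OF that]] nonneg[OF that] supp(1)[OF that]
    by (simp_all add: sum_pos_of_support support_normalize_on W)
  show "continuous_map X euclideanreal (\<lambda>x. normalize_on W (f x) v)" for v
    unfolding normalize_on_def
    by (intro continuous_map_real_divide continuous_map_sum cont W) (use pos in fastforce)
  fix x assume x: "x \<in> topspace X"
  show "normalize_on W (f x) \<in> topspace (realization K)"
  proof (rule realization_memberI[OF _ _ W])
    show "support (normalize_on W (f x)) \<in> K" "support (normalize_on W (f x)) \<subseteq> W"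
      using supp' supp x by simp_all
    show "0 \<le> normalize_on W (f x) v" for v
      using nonneg[OF x] pos[OF x] by (simp add: normalize_on_def)
    show "sum (normalize_on W (f x)) W = 1"
      using pos[OF x] by (simp add: normalize_on_def sum_divide_distrib[symmetric])
  qed
qed

text \<open>The homotopies constructed below all come from here: the straight lines between the values of the
  two maps stay inside the common simplices.\<close>

lemma homotopic_if_common_simplex:
  assumes K: "abstract_complex K"
    and f: "continuous_map X (realization K) f" and g: "continuous_map X (realization K) g"
    and common: "\<And>x. x \<in> topspace X \<Longrightarrow> \<exists>\<sigma>\<in>K. support (f x) \<union> support (g x) \<subseteq> \<sigma>"
  shows "homotopic X (realization K) f g"
  unfolding homotopic_with_def
proof (intro exI[of _ "\<lambda>(t, x). \<lambda>v. (1 - t) * f x v + t * g x v"] conjI allI ballI TrueI)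
  let ?I = "top_of_set {0..1::real}"
  let ?h = "\<lambda>(t, x). \<lambda>v. (1 - t) * f x v + t * g x v"
  show "continuous_map (prod_topology ?I X) (realization K) ?h"
    unfolding continuous_map_into_realization
  proof (intro conjI allI ballI)
    fix v
    have "continuous_map (prod_topology ?I X) euclideanreal fst"
      using continuous_map_fst continuous_map_into_fulltopology by blast
    moreover have "continuous_map (prod_topology ?I X) euclideanreal (\<lambda>p. F (snd p) v)"
      if "continuous_map X (realization K) F" for F
      using continuous_map_of_snd[of ?I X euclideanreal "\<lambda>x. F x v"]
        continuous_map_coordinate[OF that, of v] by (simp add: o_def)
    ultimately show "continuous_map (prod_topology ?I X) euclideanreal (\<lambda>p. ?h p v)"
      using f g unfolding case_prod_beta by (intro continuous_intros) auto
  next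
    fix p assume "p \<in> topspace (prod_topology ?I X)"
    then obtain t x where p: "p = (t, x)" "0 \<le> t" "t \<le> 1" "x \<in> topspace X" by auto
    obtain \<sigma> where \<sigma>: "\<sigma> \<in> K" "support (f x) \<subseteq> \<sigma>" "support (g x) \<subseteq> \<sigma>"
      using common[OF p(4)] by auto
    have fin: "finite \<sigma>" using complex_simplexD(1)[OF K \<sigma>(1)] .
    have fx: "f x \<in> topspace (realization K)" and gx: "g x \<in> topspace (realization K)"
      using f g p(4) by (simp_all add: continuous_map_into_realization)
    have nonneg: "0 \<le> ?h p v" for v
      using realization_memberD(1)[OF fx, of v] realization_memberD(1)[OF gx, of v] p by simp
    have sub: "support (?h p) \<subseteq> \<sigma>"
    proof
      fix v assume "v \<in> support (?h p)"
      then have "f x v \<noteq> 0 \<or> g x v \<noteq> 0" using p by (auto simp: support_def)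
      then show "v \<in> \<sigma>" using \<sigma> by (auto simp: support_def)
    qed
    have sum1: "sum (?h p) \<sigma> = 1"
      using realization_memberD(3)[OF fx fin \<sigma>(2)] realization_memberD(3)[OF gx fin \<sigma>(3)] p
      by (simp add: sum.distrib sum_distrib_left[symmetric])
    then have "support (?h p) \<noteq> {}"
      using sum_over_support[OF fin sub] by auto
    then have "support (?h p) \<in> K"
      using complex_simplexD(3)[OF K \<sigma>(1) _ sub] by blast
    then show "?h p \<in> topspace (realization K)"
      using realization_memberI[OF nonneg _ fin sub sum1] by blast
  qed
qed auto

lemma homotopic_if_support_subset:
  assumes K: "abstract_complex K"
    and f: "continuous_map X (realization K) f" and g: "continuous_map X (realization K) g"
    and sub: "\<And>x. x \<in> topspace X \<Longrightarrow> support (f x) \<subseteq> support (g x)"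
  shows "homotopic X (realization K) f g"
proof (rule homotopic_if_common_simplex[OF K f g])
  fix x assume "x \<in> topspace X"
  then show "\<exists>\<sigma>\<in>K. support (f x) \<union> support (g x) \<subseteq> \<sigma>"
    using sub g by (metis Un_least continuous_map_into_realization order_refl realization_memberD(2))
qed

lemma support_realization_map:
  assumes J: "abstract_complex J" and x: "x \<in> topspace (realization J)"
  shows "support (realization_map \<phi> x) = \<phi> ` support x"
proof -
  have fin: "finite (support x)"
    using complex_simplexD(1)[OF J] realization_memberD(2)[OF x] by blast
  have "realization_map \<phi> x w = 0 \<longleftrightarrow> w \<notin> \<phi> ` support x" for w
  proof -
    have "realization_map \<phi> x w = 0 \<longleftrightarrow> (\<forall>v\<in>{v. v \<in> support x \<and> \<phi> v = w}. x v = 0)"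
      unfolding realization_map_def using fin realization_memberD(1)[OF x]
      by (intro sum_nonneg_eq_0_iff) auto
    then show ?thesis by (auto simp: support_def)
  qed
  then show ?thesis by (auto simp: support_def)
qed

lemma continuous_map_realization_map:
  assumes J: "abstract_complex J" "finite J" and \<phi>: "simplicial_map J K \<phi>"
  shows "continuous_map (realization J) (realization K) (realization_map \<phi>)"
  unfolding continuous_map_into_realization
proof (intro conjI allI ballI)
  fix w
  have "continuous_map (realization J) euclideanreal (\<lambda>x. \<Sum>v | v \<in> \<Union>J \<and> \<phi> v = w. x v)"
    by (intro continuous_map_sum continuous_map_realization_coordinate
        finite_subset[OF _ finite_vertices[OF J]]) auto
  then show "continuous_map (realization J) euclideanreal (\<lambda>x. realization_map \<phi> x w)"
  proof (rule continuous_map_eq)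
    fix x assume "x \<in> topspace (realization J)"
    then have "support x \<subseteq> \<Union>J" using realization_memberD(2) by blast
    then show "(\<Sum>v | v \<in> \<Union>J \<and> \<phi> v = w. x v) = realization_map \<phi> x w"
      unfolding realization_map_def 
      by (intro sum.mono_neutral_right finite_subset[OF _ finite_vertices[OF J]])
        (auto simp: support_def)
  qed
next
  fix x assume x: "x \<in> topspace (realization J)"
  have fin: "finite (support x)"
    using complex_simplexD(1)[OF J(1)] realization_memberD(2)[OF x] by blast
  show "realization_map \<phi> x \<in> topspace (realization K)"
  proof (rule realization_memberI)
    show "0 \<le> realization_map \<phi> x v" for v
      unfolding realization_map_def using realization_memberD(1)[OF x] by (simp add: sum_nonneg)
    show "support (realization_map \<phi> x) \<in> K"
      using \<phi> realization_memberD(2)[OF x] support_realization_map[OF J(1) x, of \<phi>]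
      by (simp add: simplicial_map_def)
    show "sum (realization_map \<phi> x) (\<phi> ` support x) = 1"
      unfolding realization_map_def
      using sum.image_gen[OF fin, of x \<phi>] realization_memberD(3)[OF x fin order_refl] by simp
    show "support (realization_map \<phi> x) \<subseteq> \<phi> ` support x"
      using support_realization_map[OF J(1) x, of \<phi>] by simp
  qed (use fin in simp)
qed

lemma realization_mono:
  assumes "J \<subseteq> K" "x \<in> topspace (realization J)"
  shows "x \<in> topspace (realization K)"
  using assms by (auto simp: realization_iff)

definition vertex_point :: "'a \<Rightarrow> 'a \<Rightarrow> real" where
  "vertex_point v = indicator {v}"

lemma support_vertex_point [simp]: "support (vertex_point v) = {v}"
  by (auto simp: support_def vertex_point_def indicator_def)

lemma vertex_point_in_realization:
  assumes "{v} \<in> K"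
  shows "vertex_point v \<in> topspace (realization K)"
  using assms by (auto simp: realization_iff) (simp_all add: vertex_point_def)

lemma singleton_in_complex:
  assumes "abstract_complex K" "v \<in> \<Union>K"
  shows "{v} \<in> K"
  using assms complex_simplexD(3) by fastforce

text \<open>Constant maps are moved first to a vertex of the simplex of their value and then along the edges of
  an edge path.\<close>

lemma homotopic_constant_vertex_point:
  assumes K: "abstract_complex K" "connected_complex K"
    and a: "a \<in> topspace (realization K)" and v: "v \<in> \<Union>K"
  shows "homotopic X (realization K) (\<lambda>_. a) (\<lambda>_. vertex_point v)"
proof -
  have const: "continuous_map X (realization K) (\<lambda>_. c)" if "c \<in> topspace (realization K)" for c
    using that by simp
  obtain u where u: "u \<in> support a"
    using complex_simplexD(2)[OF K(1) realization_memberD(2)[OF a]] by blast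
  then have uK: "u \<in> \<Union>K" using realization_memberD(2)[OF a] by blast
  have pt: "vertex_point w \<in> topspace (realization K)" if "w \<in> \<Union>K" for w
    by (rule vertex_point_in_realization) (rule singleton_in_complex[OF K(1) that])
  have "(u, v) \<in> {(a, b). {a, b} \<in> K}\<^sup>*"
    using K(2) uK v unfolding connected_complex_def by blast
  then have "homotopic X (realization K) (\<lambda>_. a) (\<lambda>_. vertex_point v)"
  proof (induction rule: rtrancl_induct)
    case base
    have "homotopic X (realization K) (\<lambda>_. vertex_point u) (\<lambda>_. a)"
      using u by (intro homotopic_if_support_subset[OF K(1)] const pt uK a) simp
    then show ?case by (rule homotopic_with_symD)
  next
    case (step y z)
    then have yz: "{y, z} \<in> K" by simp
    have "homotopic X (realization K) (\<lambda>_. vertex_point y) (\<lambda>_. vertex_point z)"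
      by (rule homotopic_if_common_simplex[OF K(1)])
        (use yz in \<open>auto intro!: const pt bexI[of _ "{y, z}"]\<close>)
    with step.IH show ?case by (rule homotopic_with_trans)
  qed
  then show ?thesis .
qed

section \<open>From contiguous simplicial maps to homotopies on open sets\<close>

text \<open>A continuous detector for the statement that all coordinates in \<open>F\<close> are positive and exceed all
  coordinates in \<open>W - F\<close>. For a point of a realization, the simplices \<open>F\<close> with this property, its
  dominant simplices, form the chain that carries the point in the barycentric subdivision.\<close>

definition dominance :: "'a set \<Rightarrow> 'a set \<Rightarrow> ('a \<Rightarrow> real) \<Rightarrow> real" where
  "dominance W F x = (\<Prod>v\<in>F. x v * (\<Prod>u\<in>W - F. max 0 (x v - x u)))"

lemma dominance_nonneg: "(\<And>v. 0 \<le> x v) \<Longrightarrow> 0 \<le> dominance W F x"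
  unfolding dominance_def by (intro prod_nonneg ballI mult_nonneg_nonneg) auto

lemma dominance_pos_iff:
  assumes "finite W" "F \<subseteq> W" "\<And>v. 0 \<le> x v"
  shows "0 < dominance W F x \<longleftrightarrow> (\<forall>v\<in>F. 0 < x v \<and> (\<forall>u\<in>W - F. x u < x v))"
proof -
  have fin: "finite F" using assms(1,2) finite_subset by blast
  have "dominance W F x \<noteq> 0 \<longleftrightarrow> (\<forall>v\<in>F. x v \<noteq> 0 \<and> (\<forall>u\<in>W - F. max 0 (x v - x u) \<noteq> 0))"
    using fin assms(1) by (auto simp: dominance_def)
  also have "\<dots> \<longleftrightarrow> (\<forall>v\<in>F. 0 < x v \<and> (\<forall>u\<in>W - F. x u < x v))"
    by (intro ball_cong refl conj_cong) (use assms(3) in \<open>auto simp: max_def less_le\<close>)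
  finally show ?thesis using dominance_nonneg[of x W F] assms(3) by (simp add: less_le)
qed

lemma continuous_map_dominance:
  assumes "finite W" "F \<subseteq> W" "\<And>v. continuous_map X euclideanreal (\<lambda>x. f x v)"
  shows "continuous_map X euclideanreal (\<lambda>x. dominance W F (f x))"
  unfolding dominance_def using assms finite_subset[of F W]
  by (intro continuous_intros) auto

lemma dominant_sets_chain:
  assumes "finite W" "F \<subseteq> W" "G \<subseteq> W" "\<And>v. 0 \<le> x v"
    and "0 < dominance W F x" "0 < dominance W G x"
  shows "F \<subseteq> G \<or> G \<subseteq> F"
proof (rule ccontr)
  assume "\<not> ?thesis"
  then obtain u v where uv: "u \<in> F" "u \<notin> G" "v \<in> G" "v \<notin> F" by blast
  then have "u \<in> W - G" "v \<in> W - F" using assms(2,3) by blast+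
  then have "x u < x v" "x v < x u"
    using uv assms(5,6) dominance_pos_iff[OF assms(1,2), of x] dominance_pos_iff[OF assms(1,3), of x] assms(4)
    by blast+
  then show False by simp
qed

lemma dominant_subset_support:
  assumes "finite W" "F \<subseteq> W" "\<And>v. 0 \<le> x v" "0 < dominance W F x"
  shows "F \<subseteq> support x"
  using assms dominance_pos_iff[of W F x] by (force simp: support_def)

text \<open>The vertices at which the point has its largest coordinate form a dominant simplex.\<close>

lemma dominant_simplex_exists:
  assumes M: "abstract_complex M" and W: "finite W" "\<Union>M \<subseteq> W"
    and x: "x \<in> topspace (realization M)"
  shows "\<exists>F\<in>M. 0 < dominance W F x"
proof -
  let ?S = "support x"
  have S: "?S \<in> M" "finite ?S" "?S \<noteq> {}"
    using realization_memberD(2)[OF x] complex_simplexD[OF M] by blast+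
  define m where "m = Max (x ` ?S)"
  define F where "F = {v \<in> ?S. x v = m}"
  have m: "m \<in> x ` ?S" "\<And>v. v \<in> ?S \<Longrightarrow> x v \<le> m"
    unfolding m_def using S by simp_all
  have "F \<noteq> {}" using m(1) by (auto simp: F_def)
  then have FM: "F \<in> M"
    using complex_simplexD(3)[OF M S(1)] by (auto simp: F_def)
  have mpos: "0 < m"
    using m(1) coordinate_pos_iff[OF x] by auto
  have small: "x u < m" if "u \<notin> F" for u
  proof (cases "u \<in> ?S")
    case True
    then show ?thesis using that m(2)[of u] by (auto simp: F_def)
  next
    case False
    then show ?thesis using mpos by (simp add: support_def)
  qed
  have "F \<subseteq> W" using FM W by blast
  moreover have "\<forall>v\<in>F. 0 < x v \<and> (\<forall>u\<in>W - F. x u < x v)"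
    using mpos small by (simp add: F_def)
  ultimately have "0 < dominance W F x"
    using dominance_pos_iff[OF W(1), of F x] realization_memberD(1)[OF x] by blast
  then show ?thesis using FM by blast
qed

text \<open>The map takes the dominances of the simplices as coordinates, so that each point lands in the
  same open simplex of the subdivision as under the inverse of the standard identification.\<close>

lemma map_to_subdivision_exists:
  assumes M: "abstract_complex M" "finite M"
  shows "\<exists>h. continuous_map (realization M) (realization (barycentric_subdivision M)) h \<and>
    (\<forall>x\<in>topspace (realization M). \<forall>u\<in>support (h x).
       \<exists>F. u = Bary F \<and> fset F \<in> M \<and> fset F \<subseteq> support x)"
proof -
  let ?W = "\<Union>M"
  have W: "finite ?W" using finite_vertices[OF M] .
  have FW: "F \<subseteq> ?W" if "F \<in> M" for F using that by blast
  define S where "S = {F. fset F \<in> M}"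
  have finS: "finite S"
    using finite_vimageI[OF M(2), of fset] by (simp add: S_def vimage_def fset_inject inj_on_def)
  define f where "f x u = (case u of Bary F \<Rightarrow> if F \<in> S then dominance ?W (fset F) x else 0 | Vert _ \<Rightarrow> 0)"
    for x u
  have nonneg: "0 \<le> f x u" if "x \<in> topspace (realization M)" for x u
    using realization_memberD(1)[OF that]
    by (auto simp: f_def dominance_nonneg split: sd_vertex.split)
  have supp: "support (f x) = Bary ` {F \<in> S. 0 < dominance ?W (fset F) x}"
    if "x \<in> topspace (realization M)" for x
  proof -
    have "u \<in> support (f x) \<longleftrightarrow> u \<in> Bary ` {F \<in> S. 0 < dominance ?W (fset F) x}" for u
      using realization_memberD(1)[OF that] dominance_nonneg[of x ?W]
      by (cases u) (auto simp: support_def f_def less_le)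
    then show ?thesis by blast
  qed
  have suppW: "support (f x) \<subseteq> Bary ` S" if "x \<in> topspace (realization M)" for x
    using supp[OF that] by blast
  have "continuous_map (realization M) (realization (barycentric_subdivision M))
      (\<lambda>x. normalize_on (Bary ` S) (f x))"
  proof (rule continuous_map_normalize_on)
    show "continuous_map (realization M) euclideanreal (\<lambda>x. f x u)" for u
    proof (cases u)
      case (Bary F)
      then show ?thesis
        using continuous_map_dominance[OF W FW continuous_map_realization_coordinate, of "fset F" M]
        by (simp add: f_def S_def)
    qed (simp add: f_def)
    fix x assume x: "x \<in> topspace (realization M)"
    note nn = realization_memberD(1)[OF x]
    have "subset.chain M (fset ` {F \<in> S. 0 < dominance ?W (fset F) x})"
      unfolding subset_chain_def
    proof (intro conjI ballI)
      show "fset ` {F \<in> S. 0 < dominance ?W (fset F) x} \<subseteq> M" by (auto simp: S_def)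
      fix A B assume "A \<in> fset ` {F \<in> S. 0 < dominance ?W (fset F) x}"
        "B \<in> fset ` {F \<in> S. 0 < dominance ?W (fset F) x}"
      then show "A \<subseteq> B \<or> B \<subseteq> A"
        by (intro dominant_sets_chain[OF W FW FW nn]) (auto simp: S_def)
    qed
    moreover have "{F \<in> S. 0 < dominance ?W (fset F) x} \<noteq> {}"
    proof -
      obtain F where F: "F \<in> M" "0 < dominance ?W F x"
        using dominant_simplex_exists[OF M(1) W order_refl x] by blast
      then have "fset (Abs_fset F) = F"
        using complex_simplexD(1)[OF M(1)] by (simp add: Abs_fset_inverse)
      then have "Abs_fset F \<in> {F \<in> S. 0 < dominance ?W (fset F) x}"
        using F by (simp add: S_def)
      then show ?thesis by blast
    qed
    ultimately show "support (f x) \<in> barycentric_subdivision M"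
      unfolding barycentric_subdivision_def supp[OF x] using finS
      by (intro CollectI exI[of _ "{F \<in> S. 0 < dominance ?W (fset F) x}"]) simp
  qed (use finS nonneg suppW abstract_complex_barycentric_subdivision in auto)
  moreover have "\<exists>F. u = Bary F \<and> fset F \<in> M \<and> fset F \<subseteq> support x"
    if x: "x \<in> topspace (realization M)" and u: "u \<in> support (normalize_on (Bary ` S) (f x))" for x u
  proof -
    have "u \<in> support (f x)"
      using u by (auto simp: support_def normalize_on_def)
    then obtain F where F: "u = Bary F" "fset F \<in> M" "0 < dominance ?W (fset F) x"
      using supp[OF x] by (auto simp: S_def)
    then have "fset F \<subseteq> support x"
      using dominant_subset_support[OF W FW, of "fset F" x] realization_memberD(1)[OF x] by blast
    then show ?thesis using F by blast
  qed
  ultimately show ?thesis by blast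
qed

text \<open>The open set consists of the points with a dominant simplex in the subcomplex. Dominant simplices
  form a chain, hence those in the subcomplex have a largest one, and a weighted sum of their
  indicator functions is, suitably scaled, a point in its interior.\<close>

lemma open_thickening_exists:
  assumes M: "abstract_complex M" "finite M" and J: "subcomplex J M"
  shows "\<exists>U r. openin (realization M) U \<and> topspace (realization J) \<subseteq> U \<and>
    continuous_map (subtopology (realization M) U) (realization J) r \<and>
    (\<forall>x\<in>U. support (r x) \<subseteq> support x)"
proof -
  let ?W = "\<Union>M"
  have W: "finite ?W" using finite_vertices[OF M] .
  have J': "abstract_complex J" "J \<subseteq> M" using J by (simp_all add: subcomplex_def)
  have finJ: "finite J" using J'(2) M(2) finite_subset by blast
  have FW: "F \<subseteq> ?W" if "F \<in> J" for F using that J'(2) by blast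
  define U where "U = (\<Union>F\<in>J. {x \<in> topspace (realization M). dominance ?W F x \<in> {0<..}})"
  define D where "D x = {F \<in> J. 0 < dominance ?W F x}" for x
  define f where "f x v = (\<Sum>F | F \<in> J \<and> v \<in> F. dominance ?W F x)" for x v
  have contdom: "continuous_map (realization M) euclideanreal (dominance ?W F)" if "F \<in> J" for F
    using continuous_map_dominance[OF W FW[OF that] continuous_map_realization_coordinate] .
  have "openin (realization M) U"
    unfolding U_def
    using openin_continuous_map_preimage[OF contdom, of _ "{0<..}"] by (intro openin_Union) auto
  moreover have "topspace (realization J) \<subseteq> U"
  proof
    fix x assume x: "x \<in> topspace (realization J)"
    then obtain F where "F \<in> J" "0 < dominance ?W F x"
      using dominant_simplex_exists[OF J'(1) W _ x] J'(2) by blast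
    then show "x \<in> U" using realization_mono[OF J'(2) x] by (auto simp: U_def)
  qed
  moreover have nn: "0 \<le> x v" if "x \<in> U" for x v
    using that realization_memberD(1)[of x M v] unfolding U_def by blast
  have D: "D x \<subseteq> J" "D x \<noteq> {}" "subset.chain J (D x)" if "x \<in> U" for x
  proof -
    show sub: "D x \<subseteq> J" by (auto simp: D_def)
    show "D x \<noteq> {}" using that by (auto simp: D_def U_def)
    show "subset.chain J (D x)"
      unfolding subset_chain_def
    proof (intro conjI ballI sub)
      fix F G assume "F \<in> D x" "G \<in> D x"
      then show "F \<subseteq> G \<or> G \<subseteq> F"
        by (intro dominant_sets_chain[OF W FW FW nn[OF that]]) (auto simp: D_def)
    qed
  qed
  have supp: "support (f x) = \<Union>(D x)" if "x \<in> U" for x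
  proof -
    have "f x v = 0 \<longleftrightarrow> (\<forall>F\<in>{F \<in> J. v \<in> F}. dominance ?W F x = 0)" for v
      unfolding f_def using finJ nn[OF that] by (intro sum_nonneg_eq_0_iff) (auto intro: dominance_nonneg)
    moreover have "dominance ?W F x \<noteq> 0 \<longleftrightarrow> 0 < dominance ?W F x" for F
      using dominance_nonneg[of x ?W F] nn[OF that] by (simp add: less_le)
    ultimately show ?thesis unfolding support_def D_def by blast
  qed
  have suppJ: "support (f x) \<in> J" if "x \<in> U" for x
  proof -
    have "\<Union>(D x) \<in> D x"
      using D[OF that] finite_subset[OF _ finJ] by (intro Union_in_chain)
    then show ?thesis using supp[OF that] D(1)[OF that] by auto
  qed
  have supp_le: "support (f x) \<subseteq> support x" if "x \<in> U" for x
    using dominant_subset_support[OF W FW, of _ x] nn[OF that] supp[OF that] by (auto simp: D_def)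
  have "continuous_map (subtopology (realization M) U) (realization J) (\<lambda>x. normalize_on ?W (f x))"
  proof (rule continuous_map_normalize_on[OF J'(1) W])
    show "continuous_map (subtopology (realization M) U) euclideanreal (\<lambda>x. f x v)" for v
      unfolding f_def using finJ
      by (intro continuous_map_sum continuous_map_from_subtopology contdom) auto
    fix x assume "x \<in> topspace (subtopology (realization M) U)"
    then have x: "x \<in> U" by simp
    show "0 \<le> f x v" for v
      unfolding f_def using nn[OF x] by (simp add: sum_nonneg dominance_nonneg)
    show "support (f x) \<in> J" "support (f x) \<subseteq> ?W" using suppJ[OF x] FW by blast+
  qed
  moreover have "support (normalize_on ?W (f x)) \<subseteq> support x" if "x \<in> U" for x
    using supp_le[OF that] by (auto simp: support_def normalize_on_def)
  ultimately show ?thesis by blast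
qed


text \<open>The combinatorial content of approximating the identity: the barycentre of a simplex is sent to a
  vertex of that simplex.\<close>

definition selects_vertices :: "'a set set \<Rightarrow> (nat \<Rightarrow> 'a sd_vertex \<Rightarrow> 'a sd_vertex) \<Rightarrow> bool" where
  "selects_vertices L lam \<longleftrightarrow> (\<forall>b F. fset F \<in> Sd b L \<longrightarrow> lam (Suc b) (Bary F) |\<in>| F)"

lemma Sd_0: "Sd 0 L = (`) Vert ` L"
  and Sd_Suc: "Sd (Suc b) L = barycentric_subdivision (Sd b L)"
  by (simp_all add: Sd_def)

lemma support_closed_simplex:
  assumes "x \<in> closed_simplex K \<sigma>"
  shows "support x \<subseteq> \<sigma>"
proof
  fix v assume v: "v \<in> support x"
  show "v \<in> \<sigma>"
  proof (rule ccontr)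
    assume nv: "v \<notin> \<sigma>"
    have "closedin (realization K) {y \<in> topspace (realization K). y v \<in> {0}}"
      by (rule closedin_continuous_map_preimage[OF continuous_map_realization_coordinate]) simp
    moreover have "open_simplex K \<sigma> \<subseteq> {y \<in> topspace (realization K). y v \<in> {0}}"
      using nv by (auto simp: open_simplex_def support_def)
    ultimately have "closed_simplex K \<sigma> \<subseteq> {y \<in> topspace (realization K). y v \<in> {0}}"
      unfolding closed_simplex_def by (rule closure_of_minimal[rotated])
    then show False using assms v by (auto simp: support_def)
  qed
qed

text \<open>Evaluate the approximation condition at the vertex \<open>Bary F\<close>, which is identified with an interior
  point of the simplex \<open>F\<close>.\<close>

lemma identity_approximations_select_vertices:
  assumes L: "abstract_complex L" and lam: "identity_approximations L lam"
  shows "selects_vertices L lam"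
  unfolding selects_vertices_def
proof (intro allI impI)
  fix b F assume F: "fset F \<in> Sd b L"
  let ?M = "Sd b L"
  let ?x = "vertex_point (Bary F)"
  have ne: "fset F \<noteq> {}" using complex_simplexD(2)[OF abstract_complex_Sd[OF L] F] .
  have "subset.chain ?M (fset ` {F})" using F by (simp add: subset_chain_def)
  then have "{Bary F} \<in> Sd (Suc b) L"
    unfolding Sd_Suc barycentric_subdivision_def by (intro CollectI exI[of _ "{F}"]) simp
  then have x: "?x \<in> topspace (realization (Sd (Suc b) L))"
    by (rule vertex_point_in_realization)
  have card: "0 < card (fset F)" using ne by (simp add: card_gt_0_iff)
  have id: "sd_identification ?x = (\<lambda>v. if v |\<in>| F then 1 / real (card (fset F)) else 0)"
  proof
    fix v
    have "{G. Bary G \<in> support ?x \<and> v |\<in>| G} = (if v |\<in>| F then {F} else {})" by auto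
    then show "sd_identification ?x v = (if v |\<in>| F then 1 / real (card (fset F)) else 0)"
      by (simp add: sd_identification_def vertex_point_def fcard.rep_eq)
  qed
  then have supp: "support (sd_identification ?x) = fset F"
    using card by (auto simp: support_def)
  have "sd_identification ?x \<in> topspace (realization ?M)"
    by (rule realization_memberI[of _ _ "fset F"]) (use F card ne in \<open>simp_all add: supp, simp_all add: id\<close>)
  then have "sd_identification ?x \<in> open_simplex ?M (fset F)"
    by (simp add: open_simplex_def supp)
  then have "realization_map (lam (Suc b)) ?x \<in> closed_simplex ?M (fset F)"
    using lam F x unfolding identity_approximations_def simplicial_approximation_def
    by (metis One_nat_def Suc_le_mono diff_Suc_1 le0)
  then have "support (realization_map (lam (Suc b)) ?x) \<subseteq> fset F"
    by (rule support_closed_simplex)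
  then show "lam (Suc b) (Bary F) |\<in>| F"
    using support_realization_map[OF abstract_complex_Sd[OF L] x, of "lam (Suc b)"] by simp
qed

lemma identity_approximations_simplicial:
  "identity_approximations L lam \<Longrightarrow> simplicial_map (Sd (Suc b) L) (Sd b L) (lam (Suc b))"
  unfolding identity_approximations_def simplicial_approximation_def
  by (metis One_nat_def Suc_le_mono diff_Suc_1 le0)

lemma subdivided_map_eq: "subdivided_map lam \<phi> b = \<phi> \<circ> subdivided_map lam id b"
  by (induction b) auto

lemma finite_barycentric_subdivision:
  assumes "finite M"
  shows "finite (barycentric_subdivision M)"
proof -
  have "finite {F. fset F \<in> M}"
    using finite_vimageI[OF assms, of fset] by (simp add: vimage_def fset_inject inj_on_def)
  moreover have "barycentric_subdivision M \<subseteq> Pow (Bary ` {F. fset F \<in> M})"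
    by (auto simp: barycentric_subdivision_def subset_chain_def)
  ultimately show ?thesis by (meson finite_Pow_iff finite_imageI finite_subset)
qed

lemma finite_Sd: "finite L \<Longrightarrow> finite (Sd b L)"
  by (induction b) (simp_all add: Sd_0 Sd_Suc finite_barycentric_subdivision)

lemma simplicial_map_compose:
  "simplicial_map J K f \<Longrightarrow> simplicial_map K M g \<Longrightarrow> simplicial_map J M (g \<circ> f)"
  by (simp add: simplicial_map_def flip: image_image)

lemma simplicial_subdivided_map:
  assumes lam: "identity_approximations L lam" and \<phi>: "simplicial_map L K \<phi>"
  shows "simplicial_map (Sd b L) K (subdivided_map lam \<phi> b)"
proof (induction b)
  case 0
  have "(\<phi> \<circ> base_vertex) ` Vert ` \<sigma> = \<phi> ` \<sigma>" for \<sigma> by (auto simp: image_image)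
  then show ?case using \<phi> by (auto simp: Sd_0 simplicial_map_def)
next
  case (Suc b)
  then show ?case
    unfolding subdivided_map.simps
    by (rule simplicial_map_compose[OF identity_approximations_simplicial[OF lam]])
qed

text \<open>A point of \<open>L\<close> is located in the subdivisions of \<open>L\<close> so closely that the approximations of
  the identity move it back into its own simplex.\<close>

lemma map_to_iterated_subdivision_exists:
  assumes L: "abstract_complex L" "finite L" and lam: "selects_vertices L lam"
  shows "\<exists>h. continuous_map (realization L) (realization (Sd b L)) h \<and>
    (\<forall>x\<in>topspace (realization L). subdivided_map lam id b ` support (h x) \<subseteq> support x)"
proof (induction b)
  case 0
  have "continuous_map (realization L) (realization (Sd 0 L)) (realization_map Vert)"
    by (rule continuous_map_realization_map[OF L]) (simp add: simplicial_map_def Sd_0)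
  then show ?case
    by (intro exI[of _ "realization_map Vert"]) (auto simp: support_realization_map[OF L(1)])
next
  case (Suc b)
  let ?M = "Sd b L"
  obtain h where h: "continuous_map (realization L) (realization ?M) h"
    "\<And>x. x \<in> topspace (realization L) \<Longrightarrow> subdivided_map lam id b ` support (h x) \<subseteq> support x"
    using Suc by blast
  obtain g where g: "continuous_map (realization ?M) (realization (barycentric_subdivision ?M)) g"
    "\<And>y u. y \<in> topspace (realization ?M) \<Longrightarrow> u \<in> support (g y) \<Longrightarrow>
       \<exists>F. u = Bary F \<and> fset F \<in> ?M \<and> fset F \<subseteq> support y"
    using map_to_subdivision_exists[OF abstract_complex_Sd[OF L(1)] finite_Sd[OF L(2)], of b] by blast
  have "subdivided_map lam id (Suc b) u \<in> support x"
    if x: "x \<in> topspace (realization L)" and u: "u \<in> support (g (h x))" for x u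
  proof -
    have "h x \<in> topspace (realization ?M)"
      using h(1) x by (simp add: continuous_map_into_realization)
    then obtain F where F: "u = Bary F" "fset F \<in> ?M" "fset F \<subseteq> support (h x)"
      using g(2) u by blast
    then have "lam (Suc b) u \<in> support (h x)"
      using lam unfolding selects_vertices_def by blast
    then show ?thesis using h(2)[OF x] by auto
  qed
  then have "\<forall>x\<in>topspace (realization L).
      subdivided_map lam id (Suc b) ` support ((g \<circ> h) x) \<subseteq> support x" by auto
  moreover have "continuous_map (realization L) (realization (Sd (Suc b) L)) (g \<circ> h)"
    using continuous_map_compose[OF h(1) g(1)] by (simp add: Sd_Suc)
  ultimately show ?case by blast
qed

lemma facet_containing:
  assumes "finite J" "\<sigma> \<in> J"
  shows "\<exists>\<tau>\<in>facets J. \<sigma> \<subseteq> \<tau>"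
proof -
  obtain \<tau> where "\<tau> \<in> J" "\<sigma> \<subseteq> \<tau>" "\<And>\<rho>. \<rho> \<in> J \<Longrightarrow> \<tau> \<subseteq> \<rho> \<Longrightarrow> \<rho> = \<tau>"
    using finite_has_maximal2[OF assms] by metis
  then show ?thesis by (auto simp: facets_def)
qed

lemma contiguous_common_simplex:
  assumes "abstract_complex K" "finite J" "contiguous1 J K \<phi> \<phi>'" "\<sigma> \<in> J"
  shows "\<exists>\<tau>\<in>K. \<phi> ` \<sigma> \<union> \<phi>' ` \<sigma> \<subseteq> \<tau>"
proof -
  obtain \<rho> where \<rho>: "\<rho> \<in> facets J" "\<sigma> \<subseteq> \<rho>" using facet_containing[OF assms(2,4)] by blast
  have "\<phi> ` \<rho> \<union> \<phi>' ` \<rho> \<in> K" using assms(3) \<rho>(1) by (simp add: contiguous1_def)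
  then show ?thesis
    by (rule bexI[rotated]) (use \<rho>(2) in blast)
qed

text \<open>Along the chain of maps, successive realizations take values in common simplices.\<close>

lemma contiguous_imp_homotopic:
  assumes J: "abstract_complex J" "finite J" and K: "abstract_complex K"
    and con: "contiguous c J K \<phi> \<phi>'"
  shows "homotopic (realization J) (realization K) (realization_map \<phi>) (realization_map \<phi>')"
proof -
  obtain \<psi> where \<psi>: "\<forall>v\<in>\<Union>J. \<psi> 0 v = \<phi> v" "\<forall>v\<in>\<Union>J. \<psi> c v = \<phi>' v"
    "\<forall>i\<le>c. simplicial_map J K (\<psi> i)"
    "\<forall>i\<in>{1..c}. contiguous1 J K (\<psi> (i - 1)) (\<psi> i)"
    using con unfolding contiguous_def by blast
  have cont: "continuous_map (realization J) (realization K) (realization_map (\<psi> i))" if "i \<le> c" for i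
    using continuous_map_realization_map[OF J] \<psi>(3) that by blast
  have "homotopic (realization J) (realization K) (realization_map (\<psi> 0)) (realization_map (\<psi> i))"
    if "i \<le> c" for i
    using that
  proof (induction i)
    case 0
    then show ?case using cont by simp
  next
    case (Suc i)
    have "homotopic (realization J) (realization K) (realization_map (\<psi> 0)) (realization_map (\<psi> i))"
      using Suc by simp
    moreover have "homotopic (realization J) (realization K) (realization_map (\<psi> i)) (realization_map (\<psi> (Suc i)))"
    proof (rule homotopic_if_common_simplex[OF K cont cont])
      fix x assume x: "x \<in> topspace (realization J)"
      have "contiguous1 J K (\<psi> i) (\<psi> (Suc i))" using \<psi>(4)[rule_format, of "Suc i"] Suc.prems by simp
      then show "\<exists>\<sigma>\<in>K. support (realization_map (\<psi> i) x) \<union> support (realization_map (\<psi> (Suc i)) x) \<subseteq> \<sigma>"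
        using contiguous_common_simplex[OF K J(2) _ realization_memberD(2)[OF x]]
        by (simp add: support_realization_map[OF J(1) x])
    qed (use Suc.prems in auto)
    ultimately show ?case by (rule homotopic_with_trans)
  qed
  then have hom: "homotopic (realization J) (realization K) (realization_map (\<psi> 0)) (realization_map (\<psi> c))"
    by simp
  have cong: "realization_map f x = realization_map g x"
    if "\<And>v. v \<in> \<Union>J \<Longrightarrow> f v = g v" "x \<in> topspace (realization J)" for f g :: "'a \<Rightarrow> 'b" and x
  proof -
    have "support x \<subseteq> \<Union>J" using realization_memberD(2)[OF that(2)] by blast
    then have "{v \<in> support x. f v = w} = {v \<in> support x. g v = w}" for w using that(1) by force
    then show ?thesis by (simp add: realization_map_def)
  qed
  show ?thesis
    by (rule homotopic_with_eq[OF hom]) (use \<psi>(1,2) in \<open>auto intro!: cong\<close>)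
qed

text \<open>On the preimage under \<open>h\<close> of the thickening of \<open>J\<close>, each of the two maps is homotopic to its
  composite with \<open>h\<close>, the map from the thickening to \<open>J\<close> and the approximations of the identity. Contiguity
  compares these composites.\<close>

lemma homotopic_on_open_set_if_contiguous:
  assumes L: "abstract_complex L" "finite L" and K: "abstract_complex K"
    and \<phi>: "simplicial_map L K \<phi>" "simplicial_map L K \<phi>'"
    and J: "subcomplex J (Sd b L)"
    and con: "contiguous c J K (subdivided_map lam \<phi> b) (subdivided_map lam \<phi>' b)"
    and simpl: "\<And>\<phi>. simplicial_map L K \<phi> \<Longrightarrow> simplicial_map (Sd b L) K (subdivided_map lam \<phi> b)"
    and h: "continuous_map (realization L) (realization (Sd b L)) h"
      "\<And>x. x \<in> topspace (realization L) \<Longrightarrow> subdivided_map lam id b ` support (h x) \<subseteq> support x"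
  shows "\<exists>U. openin (realization L) U \<and>
    (\<forall>x\<in>topspace (realization L). h x \<in> topspace (realization J) \<longrightarrow> x \<in> U) \<and>
    homotopic (subtopology (realization L) U) (realization K) (realization_map \<phi>) (realization_map \<phi>')"
proof -
  let ?M = "Sd b L"
  have J': "abstract_complex J" "J \<subseteq> ?M" "finite J"
    using J finite_Sd[OF L(2)] finite_subset by (auto simp: subcomplex_def)
  obtain V r where V: "openin (realization ?M) V" "topspace (realization J) \<subseteq> V"
    and r: "continuous_map (subtopology (realization ?M) V) (realization J) r"
      "\<And>y. y \<in> V \<Longrightarrow> support (r y) \<subseteq> support y"
    using open_thickening_exists[OF abstract_complex_Sd[OF L(1)] finite_Sd[OF L(2)] J] by blast
  define U where "U = {x \<in> topspace (realization L). h x \<in> V}"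
  let ?U = "subtopology (realization L) U"
  have "continuous_map ?U (subtopology (realization ?M) V) h"
    using h(1) by (auto simp: U_def continuous_map_in_subtopology continuous_map_from_subtopology)
  then have g: "continuous_map ?U (realization J) (r \<circ> h)"
    using r(1) by (rule continuous_map_compose)
  have unmove: "homotopic ?U (realization K) (realization_map (subdivided_map lam f b) \<circ> (r \<circ> h)) (realization_map f)"
    if f: "simplicial_map L K f" for f
  proof (rule homotopic_if_support_subset[OF K])
    have "simplicial_map J K (subdivided_map lam f b)"
      using simpl[OF f] J'(2) by (auto simp: simplicial_map_def)
    then show "continuous_map ?U (realization K) (realization_map (subdivided_map lam f b) \<circ> (r \<circ> h))"
      using continuous_map_compose[OF g continuous_map_realization_map[OF J'(1,3)]] by blast
    show "continuous_map ?U (realization K) (realization_map f)"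
      using continuous_map_realization_map[OF L f] by (rule continuous_map_from_subtopology)
    fix x assume "x \<in> topspace ?U"
    then have x: "x \<in> topspace (realization L)" "h x \<in> V" "x \<in> topspace ?U" by (auto simp: U_def)
    have gx: "r (h x) \<in> topspace (realization J)"
      using g x(3) by (simp add: continuous_map_into_realization)
    have "subdivided_map lam f b ` support (r (h x)) \<subseteq> f ` subdivided_map lam id b ` support (h x)"
      using r(2)[OF x(2)] unfolding subdivided_map_eq[of lam f] by auto
    also have "\<dots> \<subseteq> f ` support x" using h(2)[OF x(1)] by (rule image_mono)
    finally show "support ((realization_map (subdivided_map lam f b) \<circ> (r \<circ> h)) x) \<subseteq> support (realization_map f x)"
      using support_realization_map[OF J'(1) gx, of "subdivided_map lam f b"]
        support_realization_map[OF L(1) x(1), of f] by simp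
  qed
  have "homotopic ?U (realization K) (realization_map (subdivided_map lam \<phi> b) \<circ> (r \<circ> h))
      (realization_map (subdivided_map lam \<phi>' b) \<circ> (r \<circ> h))"
    by (rule homotopic_with_compose_continuous_map_right
        [OF contiguous_imp_homotopic[OF J'(1,3) K con] g]) simp
  then have "homotopic ?U (realization K) (realization_map \<phi>) (realization_map \<phi>')"
    using unmove[OF \<phi>(1)] unmove[OF \<phi>(2)] by (meson homotopic_with_symD homotopic_with_trans)
  moreover have "openin (realization L) U"
    unfolding U_def using h(1) V(1) by (rule openin_continuous_map_preimage)
  moreover have "\<forall>x\<in>topspace (realization L). h x \<in> topspace (realization J) \<longrightarrow> x \<in> U"
    using V(2) by (auto simp: U_def)
  ultimately show ?thesis by blast
qed

section \<open>Compactness and uniform radii\<close>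

text \<open>The realization is a closed subset of a cube, which is compact by Tychonoff.\<close>

lemma compact_space_realization:
  assumes K: "abstract_complex K" "finite K"
  shows "compact_space (realization K)"
proof -
  let ?P = "powertop_real UNIV :: ('a \<Rightarrow> real) topology"
  let ?A = "topspace (realization K)"
  let ?C = "\<lambda>\<sigma>. {x::'a \<Rightarrow> real. (\<forall>v. 0 \<le> x v) \<and> (\<forall>v\<in>-\<sigma>. x v = 0) \<and> sum x \<sigma> = 1}"
  have "?A = (\<Union>\<sigma>\<in>K. ?C \<sigma>)"
  proof (intro set_eqI iffI)
    fix x assume "x \<in> ?A"
    then show "x \<in> (\<Union>\<sigma>\<in>K. ?C \<sigma>)"
      by (intro UN_I[of "support x"]) (auto simp: realization_iff support_def)
  next
    fix x assume "x \<in> (\<Union>\<sigma>\<in>K. ?C \<sigma>)"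
    then obtain \<sigma> where \<sigma>: "\<sigma> \<in> K" "\<And>v. 0 \<le> x v" "\<And>v. v \<notin> \<sigma> \<Longrightarrow> x v = 0" "sum x \<sigma> = 1"
      by auto
    have sub: "support x \<subseteq> \<sigma>" using \<sigma>(3) by (auto simp: support_def)
    have "support x \<noteq> {}"
      using sum_over_support[OF complex_simplexD(1)[OF K(1) \<sigma>(1)] sub] \<sigma>(4) by auto
    then have "support x \<in> K" using complex_simplexD(3)[OF K(1) \<sigma>(1) _ sub] by blast
    then show "x \<in> ?A"
      by (rule realization_memberI[OF \<sigma>(2) _ complex_simplexD(1)[OF K(1) \<sigma>(1)] sub \<sigma>(4)])
  qed
  moreover have "closedin ?P (?C \<sigma>)" for \<sigma>
    unfolding euclidean_product_topology closed_closedin[symmetric] Ball_def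
    by (intro closed_Collect_conj closed_Collect_all closed_Collect_imp closed_Collect_le
        closed_Collect_eq open_Collect_const continuous_intros continuous_on_product_coordinates)
  ultimately have "closedin ?P ?A" using K(2) by (auto intro!: closedin_Union)
  moreover have "?A \<subseteq> (\<Pi>\<^sub>E v\<in>UNIV. {0..1})"
  proof
    fix x assume x: "x \<in> ?A"
    have "x v \<le> 1" for v
    proof (cases "v \<in> support x")
      case True
      then have "x v \<le> sum x (support x)"
        using complex_simplexD(1)[OF K(1) realization_memberD(2)[OF x]] realization_memberD(1)[OF x]
        by (intro member_le_sum) auto
      then show ?thesis using x by (simp add: realization_iff)
    qed (simp add: support_def)
    then show "x \<in> (\<Pi>\<^sub>E v\<in>UNIV. {0..1})" using realization_memberD(1)[OF x] by auto
  qed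
  moreover have "compactin ?P (\<Pi>\<^sub>E v\<in>UNIV. {0..1})"
    by (simp add: compactin_PiE)
  ultimately have "compactin ?P ?A" using closed_compactin by blast
  then show ?thesis
    by (simp add: realization_def compact_space_subtopology)
qed

text \<open>With \<open>V\<close> the finite vertex set this is a metric on the realization; summing over \<open>V\<close> alone makes it
  available for an arbitrary type of vertices.\<close>

definition coordinate_dist :: "'a set \<Rightarrow> ('a \<Rightarrow> real) \<Rightarrow> ('a \<Rightarrow> real) \<Rightarrow> real" where
  "coordinate_dist V x y = (\<Sum>v\<in>V. \<bar>x v - y v\<bar>)"

lemma coordinate_dist_triangle: "coordinate_dist V x z \<le> coordinate_dist V x y + coordinate_dist V y z"
  unfolding coordinate_dist_def sum.distrib[symmetric] by (intro sum_mono) simp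

lemma coordinate_dist_nonneg: "0 \<le> coordinate_dist V x y"
  unfolding coordinate_dist_def by (simp add: sum_nonneg)

lemma openin_coordinate_ball:
  assumes "finite V"
  shows "openin (realization K) {y \<in> topspace (realization K). coordinate_dist V x y < e}"
proof -
  have "continuous_map (realization K) euclideanreal (\<lambda>y. coordinate_dist V x y)"
    unfolding coordinate_dist_def
    by (intro continuous_intros continuous_map_realization_coordinate assms)
  from openin_continuous_map_preimage[OF this, of "{..<e}"] show ?thesis by simp
qed

text \<open>A basic open set of the product topology restricts finitely many coordinates, and the coordinates
  outside of the vertex set vanish.\<close>

lemma coordinate_ball_in_open_set:
  assumes K: "abstract_complex K" "finite K" and N: "openin (realization K) N" "x \<in> N"
  shows "\<exists>e>0. \<forall>y\<in>topspace (realization K). coordinate_dist (\<Union>K) x y < e \<longrightarrow> y \<in> N"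
proof -
  let ?V = "\<Union>K"
  obtain T where T: "openin (powertop_real UNIV) T" "N = T \<inter> topspace (realization K)"
    using N(1) unfolding realization_def openin_subtopology by auto
  then obtain B where B: "finite {v. B v \<noteq> UNIV}" "\<And>v. open (B v)" "x \<in> Pi\<^sub>E UNIV B" "Pi\<^sub>E UNIV B \<subseteq> T"
    using N(2) unfolding openin_product_topology_alt by (auto simp: PiE_UNIV_domain)
  have "\<exists>e>0. \<forall>s. \<bar>x v - s\<bar> < e \<longrightarrow> s \<in> B v" for v
    using B(2)[of v] B(3) unfolding open_dist by (force simp: dist_real_def abs_minus_commute)
  then obtain e where e: "\<And>v. e v > 0" "\<And>v s. \<bar>x v - s\<bar> < e v \<Longrightarrow> s \<in> B v" by metis
  define d where "d = Min (insert 1 (e ` ?V))"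
  have finV: "finite ?V" using finite_vertices[OF K] .
  have d: "d > 0" "\<And>v. v \<in> ?V \<Longrightarrow> d \<le> e v"
    using finV e(1) by (auto simp: d_def)
  have "y \<in> N" if y: "y \<in> topspace (realization K)" "coordinate_dist ?V x y < d" for y
  proof -
    have "y v \<in> B v" for v
    proof (cases "v \<in> ?V")
      case True
      then have "\<bar>x v - y v\<bar> \<le> coordinate_dist ?V x y"
        unfolding coordinate_dist_def using finV by (intro member_le_sum) auto
      then show ?thesis using e(2)[of v "y v"] d(2)[OF True] y(2) by simp
    next
      case False
      have "x \<in> topspace (realization K)" using N by (meson openin_subset subsetD)
      then have "v \<notin> support x" "v \<notin> support y"
        using False y(1) realization_memberD(2) by blast+
      then show ?thesis using e(2)[of v "y v"] e(1)[of v] by (simp add: support_def)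
    qed
    then have "y \<in> T" using B(4) by (auto simp: PiE_UNIV_domain)
    then show ?thesis using T(2) y(1) by simp
  qed
  then show ?thesis using d(1) by blast
qed

text \<open>The argument behind Lebesgue numbers, for any property of balls that passes to the balls inside:
  cover the space by finitely many balls of half the radius that is available at their centres.\<close>

lemma uniform_radius_exists:
  fixes d :: "'a \<Rightarrow> 'a \<Rightarrow> real"
  assumes X: "compact_space X"
    and d: "\<And>x. x \<in> topspace X \<Longrightarrow> d x x = 0"
    and ball: "\<And>x e. x \<in> topspace X \<Longrightarrow> openin X {y \<in> topspace X. d x y < e}"
    and inherit: "\<And>x x' e e'. \<lbrakk>x \<in> topspace X; x' \<in> topspace X; d x x' + e' \<le> e; 0 < e'; R x e\<rbrakk> \<Longrightarrow> R x' e'"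
    and ex: "\<And>x. x \<in> topspace X \<Longrightarrow> \<exists>e>0. R x e"
  shows "\<exists>e>0. \<forall>x\<in>topspace X. R x e"
proof -
  obtain e where e: "\<And>x. x \<in> topspace X \<Longrightarrow> e x > 0 \<and> R x (e x)"
    using ex by metis
  define B where "B x = {y \<in> topspace X. d x y < e x / 2}" for x
  have openB: "openin X (B x)" if "x \<in> topspace X" for x
    unfolding B_def using that by (rule ball)
  have "\<forall>U\<in>B ` topspace X. openin X U" using openB by blast
  moreover have "\<Union>(B ` topspace X) = topspace X"
    using e d by (force simp: B_def)
  ultimately obtain \<F> where \<F>: "finite \<F>" "\<F> \<subseteq> B ` topspace X" "\<Union>\<F> = topspace X"
    using X unfolding compact_space_alt by (metis order_refl subset_antisym Union_mono)
  then obtain F where F: "finite F" "F \<subseteq> topspace X" "\<F> = B ` F"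
    by (metis finite_subset_image)
  define r where "r = Min (insert 1 ((\<lambda>x. e x / 2) ` F))"
  have "r > 0" using F(1,2) e by (auto simp: r_def)
  moreover have "R y r" if y: "y \<in> topspace X" for y
  proof -
    obtain x where x: "x \<in> F" "y \<in> B x" using y \<F>(3) F(3) by blast
    have "r \<le> e x / 2" unfolding r_def using F(1) x(1) by (intro Min_le) auto
    moreover have "d x y < e x / 2" using x(2) by (simp add: B_def)
    ultimately have "d x y + r \<le> e x" by simp
    then show ?thesis using inherit[of x y r "e x"] e F(2) x(1) y \<open>r > 0\<close> by blast
  qed
  ultimately show ?thesis by blast
qed

text \<open>For a homotopy \<open>H\<close> on \<open>U\<close> with values in a realization: the ball lies in \<open>U\<close>, and during short
  time intervals its whole image lies in the open star of a single vertex.\<close>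

definition star_controlled ::
  "'a set set \<Rightarrow> ('a \<Rightarrow> real) set \<Rightarrow> (real \<times> ('a \<Rightarrow> real) \<Rightarrow> 'b \<Rightarrow> real) \<Rightarrow> ('a \<Rightarrow> real) \<Rightarrow> real \<Rightarrow> bool" where
  "star_controlled L U H x e \<longleftrightarrow>
     (\<forall>t\<in>{0..1}. \<exists>w. \<forall>y\<in>topspace (realization L). \<forall>s\<in>{0..1}.
        coordinate_dist (\<Union>L) x y < e \<longrightarrow> \<bar>s - t\<bar> < e \<longrightarrow> y \<in> U \<and> 0 < H (s, y) w)"

lemma star_controlled_mono:
  assumes "coordinate_dist (\<Union>L) x x' + e' \<le> e" "star_controlled L U H x e"
  shows "star_controlled L U H x' e'"
  unfolding star_controlled_def
proof
  fix t :: real assume "t \<in> {0..1}"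
  then obtain w where w: "\<And>y s. \<lbrakk>y \<in> topspace (realization L); s \<in> {0..1};
      coordinate_dist (\<Union>L) x y < e; \<bar>s - t\<bar> < e\<rbrakk> \<Longrightarrow> y \<in> U \<and> 0 < H (s, y) w"
    using assms(2) unfolding star_controlled_def by meson
  show "\<exists>w. \<forall>y\<in>topspace (realization L). \<forall>s\<in>{0..1}.
      coordinate_dist (\<Union>L) x' y < e' \<longrightarrow> \<bar>s - t\<bar> < e' \<longrightarrow> y \<in> U \<and> 0 < H (s, y) w"
  proof (intro exI[of _ w] ballI impI)
    fix y and s :: real
    assume ys: "y \<in> topspace (realization L)" "s \<in> {0..1}"
      "coordinate_dist (\<Union>L) x' y < e'" "\<bar>s - t\<bar> < e'"
    show "y \<in> U \<and> 0 < H (s, y) w"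
      using ys(3,4) assms(1) coordinate_dist_nonneg[of "\<Union>L" x x']
        coordinate_dist_triangle[of "\<Union>L" x y x']
      by (intro w ys(1,2)) linarith+
  qed
qed

text \<open>Locally in time the open star of a vertex with positive coordinate serves; compactness of the unit
  interval makes the radius uniform in time.\<close>

lemma star_controlled_exists:
  assumes L: "abstract_complex L" "finite L" and K: "abstract_complex K"
    and U: "openin (realization L) U" "x \<in> U"
    and H: "continuous_map (prod_topology (top_of_set {0..1}) (subtopology (realization L) U)) (realization K) H"
  shows "\<exists>e>0. star_controlled L U H x e"
proof -
  let ?I = "top_of_set {0..1::real}"
  let ?U = "subtopology (realization L) U"
  define R where "R t e \<longleftrightarrow> (\<exists>w. \<forall>y\<in>topspace (realization L). \<forall>s\<in>{0..1}.
    coordinate_dist (\<Union>L) x y < e \<longrightarrow> \<bar>s - t\<bar> < e \<longrightarrow> y \<in> U \<and> 0 < H (s, y) w)" for t e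
  have xL: "x \<in> topspace (realization L)" using U by (meson openin_subset subsetD)
  have "\<exists>e>0. \<forall>t\<in>topspace ?I. R t e"
  proof (rule uniform_radius_exists[of ?I "\<lambda>t s. \<bar>s - t\<bar>"])
    show "compact_space ?I" by (simp add: compact_space_subtopology)
    show "openin ?I {y \<in> topspace ?I. \<bar>y - t\<bar> < e}" for t e
    proof -
      have "{y \<in> topspace ?I. \<bar>y - t\<bar> < e} = {0..1} \<inter> ball t e"
        by (auto simp: dist_real_def)
      then show ?thesis by (simp add: openin_open_Int)
    qed
    fix t t' e e' :: real
    assume *: "\<bar>t' - t\<bar> + e' \<le> e" "0 < e'" "R t e"
    obtain w where w: "\<And>y s. \<lbrakk>y \<in> topspace (realization L); s \<in> {0..1};
        coordinate_dist (\<Union>L) x y < e; \<bar>s - t\<bar> < e\<rbrakk> \<Longrightarrow> y \<in> U \<and> 0 < H (s, y) w"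
      using *(3) unfolding R_def by meson
    show "R t' e'"
      unfolding R_def
    proof (intro exI[of _ w] ballI impI)
      fix y and s :: real
      assume "y \<in> topspace (realization L)" "s \<in> {0..1}" "coordinate_dist (\<Union>L) x y < e'" "\<bar>s - t'\<bar> < e'"
      then show "y \<in> U \<and> 0 < H (s, y) w" using *(1) by (intro w) linarith+
    qed
  next
    fix t assume t: "t \<in> topspace ?I"
    have Hx: "H (t, x) \<in> topspace (realization K)"
      using H t U(2) xL by (simp add: continuous_map_into_realization)
    then obtain w where "w \<in> support (H (t, x))"
      using complex_simplexD(2)[OF K realization_memberD(2)[OF Hx]] by blast
    then have w: "0 < H (t, x) w" by (simp add: coordinate_pos_iff[OF Hx])
    have "openin (prod_topology ?I ?U) {p \<in> topspace (prod_topology ?I ?U). H p w \<in> {0<..}}"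
      by (rule openin_continuous_map_preimage[OF continuous_map_coordinate[OF H]]) simp
    moreover have "(t, x) \<in> {p \<in> topspace (prod_topology ?I ?U). H p w \<in> {0<..}}"
      using w t xL U(2) by simp
    ultimately obtain A B where AB: "openin ?I A" "openin ?U B" "t \<in> A" "x \<in> B"
      "A \<times> B \<subseteq> {p \<in> topspace (prod_topology ?I ?U). H p w \<in> {0<..}}"
      unfolding openin_prod_topology_alt by meson
    have "openin (realization L) B" using AB(2) U(1) openin_trans_full by blast
    then obtain e1 where e1: "e1 > 0"
      "\<And>y. \<lbrakk>y \<in> topspace (realization L); coordinate_dist (\<Union>L) x y < e1\<rbrakk> \<Longrightarrow> y \<in> B"
      using coordinate_ball_in_open_set[OF L _ AB(4)] by blast
    obtain e2 where e2: "e2 > 0" "\<And>s. \<lbrakk>s \<in> {0..1}; \<bar>s - t\<bar> < e2\<rbrakk> \<Longrightarrow> s \<in> A"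
      using AB(1,3) unfolding openin_euclidean_subtopology_iff by (auto simp: dist_real_def)
    have "y \<in> U \<and> 0 < H (s, y) w" if "y \<in> topspace (realization L)" "s \<in> {0..1}"
      "coordinate_dist (\<Union>L) x y < min e1 e2" "\<bar>s - t\<bar> < min e1 e2" for y s
    proof -
      have "(s, y) \<in> A \<times> B" using e1(2)[OF that(1)] e2(2)[OF that(2)] that(3,4) by simp
      then show ?thesis using AB(5) by auto
    qed
    then have "R t (min e1 e2)" unfolding R_def by blast
    then show "\<exists>e>0. R t e" using e1(1) e2(1) by (intro exI[of _ "min e1 e2"]) simp
  qed simp
  then show ?thesis unfolding star_controlled_def R_def by simp
qed

section \<open>Vertices of iterated subdivisions as points\<close>

text \<open>The point of the realization of the original complex at which the standard identifications place
  the vertex.\<close>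

function position :: "'a sd_vertex \<Rightarrow> 'a \<Rightarrow> real" where
  "position (Vert v) = vertex_point v"
| "position (Bary F) = (\<lambda>a. (\<Sum>u\<in>fset F. position u a) / real (card (fset F)))"
  by pat_completeness auto
termination
proof (relation "Wellfounded.measure size")
  fix F :: "'a sd_vertex fset" and u :: "'a sd_vertex"
  assume "u \<in> fset F"
  then have "Suc (size u) \<le> (\<Sum>x\<in>fset F. Suc (size x))"
    by (intro member_le_sum) auto
  then show "(u, Bary F) \<in> Wellfounded.measure size" by simp
qed simp

definition centroid :: "'a sd_vertex set \<Rightarrow> 'a \<Rightarrow> real" where
  "centroid \<sigma> = (\<lambda>a. (\<Sum>u\<in>\<sigma>. position u a) / real (card \<sigma>))"

lemma position_Bary: "position (Bary F) = centroid (fset F)"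
  by (simp add: centroid_def)

lemma position_nonneg: "0 \<le> position u a"
  by (induction u) (auto simp: vertex_point_def indicator_def intro!: divide_nonneg_nonneg sum_nonneg)

lemma support_centroid:
  assumes "finite \<sigma>"
  shows "support (centroid \<sigma>) = (\<Union>u\<in>\<sigma>. support (position u))"
proof -
  have "centroid \<sigma> a = 0 \<longleftrightarrow> (\<forall>u\<in>\<sigma>. position u a = 0)" for a
  proof -
    have "(\<Sum>u\<in>\<sigma>. position u a) = 0 \<longleftrightarrow> (\<forall>u\<in>\<sigma>. position u a = 0)"
      by (rule sum_nonneg_eq_0_iff[OF assms position_nonneg])
    then show ?thesis using assms by (auto simp: centroid_def)
  qed
  then show ?thesis by (auto simp: support_def)
qed

lemma Sd_Suc_cases:
  assumes "\<sigma> \<in> Sd (Suc b) L"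
  obtains C F where "\<sigma> = Bary ` C" "finite C" "C \<noteq> {}" "subset.chain (Sd b L) (fset ` C)"
    "F \<in> C" "\<And>G. G \<in> C \<Longrightarrow> fset G \<in> Sd b L" "\<And>G. G \<in> C \<Longrightarrow> fset G \<subseteq> fset F"
proof -
  obtain C where C: "\<sigma> = Bary ` C" "C \<noteq> {}" "finite C" "subset.chain (Sd b L) (fset ` C)"
    using assms unfolding Sd_Suc barycentric_subdivision_def by blast
  obtain F where "F \<in> C" "\<forall>G\<in>C. fset G \<subseteq> fset F" using fset_chain_max[OF C(3,2,4)] by blast
  moreover have "\<And>G. G \<in> C \<Longrightarrow> fset G \<in> Sd b L" using C(4) by (auto simp: subset_chain_def)
  ultimately show ?thesis using C that by blast
qed

text \<open>The largest member of a chain of simplices already contains all vertices that occur, so the support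
  is again a simplex of \<open>L\<close>.\<close>

lemma centroid_in_realization:
  assumes L: "abstract_complex L" "finite L" and \<sigma>: "\<sigma> \<in> Sd b L"
  shows "centroid \<sigma> \<in> topspace (realization L)"
proof -
  let ?V = "\<Union>L"
  have finV: "finite ?V" using finite_vertices[OF L] .
  have "support (centroid \<sigma>) \<in> L \<and> sum (centroid \<sigma>) ?V = 1"
    if "\<sigma> \<in> Sd b L" for \<sigma>
    using that
  proof (induction b arbitrary: \<sigma>)
    case 0
    then obtain s where s: "\<sigma> = Vert ` s" "s \<in> L" by (auto simp: Sd_0)
    have fin: "finite s" "s \<noteq> {}" "s \<subseteq> ?V" using complex_simplexD[OF L(1) s(2)] s(2) by auto
    have "sum (vertex_point v) ?V = 1" if "v \<in> s" for v
    proof (rule realization_memberD(3)[OF vertex_point_in_realization finV])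
      show "{v} \<in> L" using that fin(3) by (intro singleton_in_complex[OF L(1)]) blast
    qed (use that fin(3) in auto)
    then have "(\<Sum>a\<in>?V. \<Sum>u\<in>\<sigma>. position u a) = card \<sigma>"
      unfolding s(1) by (subst sum.swap) (simp add: sum.reindex inj_on_def card_image)
    moreover have "card \<sigma> > 0" using fin s(1) by (simp add: card_gt_0_iff)
    ultimately have "sum (centroid \<sigma>) ?V = 1"
      by (simp add: centroid_def sum_divide_distrib[symmetric])
    moreover have "support (centroid \<sigma>) = s" using fin by (simp add: s(1) support_centroid)
    ultimately show ?case using s(2) by simp
  next
    case (Suc b)
    obtain C F where C: "\<sigma> = Bary ` C" "finite C" "C \<noteq> {}" "F \<in> C"
      "\<And>G. G \<in> C \<Longrightarrow> fset G \<in> Sd b L" "\<And>G. G \<in> C \<Longrightarrow> fset G \<subseteq> fset F"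
      using Sd_Suc_cases[OF Suc.prems] by metis
    have "(\<Sum>a\<in>?V. \<Sum>u\<in>\<sigma>. position u a) = (\<Sum>u\<in>\<sigma>. sum (position u) ?V)"
      by (rule sum.swap)
    also have "\<dots> = (\<Sum>u\<in>\<sigma>. 1)"
      using Suc.IH C(5) by (intro sum.cong refl) (auto simp: C(1) position_Bary simp del: position.simps)
    finally have "(\<Sum>a\<in>?V. \<Sum>u\<in>\<sigma>. position u a) = card \<sigma>" by simp
    moreover have "card \<sigma> > 0" using C(1-3) by (simp add: card_gt_0_iff)
    ultimately have "sum (centroid \<sigma>) ?V = 1"
      by (simp add: centroid_def sum_divide_distrib[symmetric])
    moreover have "support (centroid \<sigma>) = support (centroid (fset F))"
    proof -
      have "support (centroid \<sigma>) = (\<Union>G\<in>C. \<Union>u\<in>fset G. support (position u))"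
        using C(1,2) by (simp add: support_centroid position_Bary del: position.simps)
      also have "\<dots> = (\<Union>u\<in>fset F. support (position u))"
        using C(4,6) by blast
      finally show ?thesis by (simp add: support_centroid)
    qed
    ultimately show ?case using Suc.IH[OF C(5)[OF C(4)]] by simp
  qed
  from this[OF \<sigma>] have supp: "support (centroid \<sigma>) \<in> L" and sum1: "sum (centroid \<sigma>) ?V = 1" by auto
  show ?thesis
  proof (rule realization_memberI[OF _ supp finV _ sum1])
    show "0 \<le> centroid \<sigma> a" for a
      by (simp add: centroid_def position_nonneg sum_nonneg)
  qed (use supp in blast)
qed

text \<open>This attaches the two given maps to the ends of the chain of approximations: they send a simplex of
  \<open>Sd b L\<close> into the simplex that carries the image of its centroid.\<close>

lemma selected_vertex_in_support_position:
  assumes lam: "selects_vertices L lam" and u: "u \<in> \<Union>(Sd b L)"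
  shows "subdivided_map lam id b u \<in> support (position u)"
  using u
proof (induction b arbitrary: u)
  case 0
  then show ?case by (auto simp: Sd_0)
next
  case (Suc b)
  then obtain \<sigma> where \<sigma>: "u \<in> \<sigma>" "\<sigma> \<in> Sd (Suc b) L" by blast
  obtain F where F: "u = Bary F" "fset F \<in> Sd b L"
    using Sd_Suc_cases[OF \<sigma>(2)] \<sigma>(1) by (metis imageE)
  then have w: "lam (Suc b) u \<in> fset F" using lam by (simp add: selects_vertices_def)
  then have "subdivided_map lam id b (lam (Suc b) u) \<in> support (position (lam (Suc b) u))"
    using Suc.IH F(2) by blast
  then have "subdivided_map lam id b (lam (Suc b) u) \<in> support (position u)"
    unfolding F(1) position_Bary using w F(1) by (auto simp: support_centroid)
  then show ?case by (simp only: subdivided_map.simps o_apply)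
qed

text \<open>The simplices in a chain are told apart by their sizes, so subdividing does not raise the bound on
  the number of vertices.\<close>

lemma card_simplex_Sd:
  assumes L: "abstract_complex L" "finite L" and \<sigma>: "\<sigma> \<in> Sd b L"
  shows "card \<sigma> \<le> card (\<Union>L)"
  using \<sigma>
proof (induction b arbitrary: \<sigma>)
  case 0
  then obtain s where s: "\<sigma> = Vert ` s" "s \<in> L" by (auto simp: Sd_0)
  then have "card s \<le> card (\<Union>L)" using finite_vertices[OF L] by (intro card_mono) auto
  then show ?case by (simp add: s(1) card_image inj_on_def)
next
  case (Suc b)
  obtain C where C: "\<sigma> = Bary ` C" "finite C" "subset.chain (Sd b L) (fset ` C)"
    "\<And>G. G \<in> C \<Longrightarrow> fset G \<in> Sd b L"
    using Sd_Suc_cases[OF Suc.prems] by metis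
  have "inj_on (\<lambda>F. card (fset F)) C"
  proof (rule inj_onI)
    fix F G assume FG: "F \<in> C" "G \<in> C" "card (fset F) = card (fset G)"
    then have "fset F \<subseteq> fset G \<or> fset G \<subseteq> fset F" using C(3) by (auto simp: subset_chain_def)
    then show "F = G" using FG(3) by (metis card_subset_eq finite_fset fset_inject)
  qed
  moreover have "(\<lambda>F. card (fset F)) ` C \<subseteq> {1..card (\<Union>L)}"
  proof
    fix k assume "k \<in> (\<lambda>F. card (fset F)) ` C"
    then obtain G where G: "G \<in> C" "k = card (fset G)" by blast
    then have "fset G \<noteq> {}" using complex_simplexD(2)[OF abstract_complex_Sd[OF L(1)] C(4)] by blast
    then have "0 < k" using G(2) by (simp add: card_gt_0_iff)
    then show "k \<in> {1..card (\<Union>L)}" using Suc.IH[OF C(4)[OF G(1)]] G(2) by simp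
  qed
  ultimately have "card C \<le> card {1..card (\<Union>L)}"
    by (intro card_inj_on_le) auto
  then show ?case by (simp add: C(1) card_image inj_on_def)
qed

lemma average_close:
  fixes p :: "'a \<Rightarrow> real"
  assumes "finite F" "F \<noteq> {}" "\<And>u. u \<in> F \<Longrightarrow> \<bar>p u - c\<bar> \<le> r"
  shows "\<bar>sum p F / card F - c\<bar> \<le> r"
proof -
  have card: "0 < real (card F)" using assms(1,2) by (simp add: card_gt_0_iff)
  have "\<bar>\<Sum>u\<in>F. p u - c\<bar> \<le> (\<Sum>u\<in>F. r)"
    by (rule order_trans[OF sum_abs]) (rule sum_mono, rule assms(3))
  then have "\<bar>sum p F - real (card F) * c\<bar> \<le> real (card F) * r"
    by (simp add: sum_subtractf)
  moreover have "sum p F / card F - c = (sum p F - real (card F) * c) / real (card F)"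
    using card by (simp add: field_simps)
  ultimately show ?thesis using card by (simp add: abs_divide field_simps)
qed

text \<open>The term of the average that belongs to the given member is zero; this is what shrinks the
  diameter under subdivision.\<close>

lemma average_close_to_member:
  fixes p :: "'a \<Rightarrow> real"
  assumes "finite G" "u \<in> G" "\<And>u'. u' \<in> G \<Longrightarrow> \<bar>p u - p u'\<bar> \<le> e" "card G \<le> n"
  shows "\<bar>p u - sum p G / card G\<bar> \<le> (1 - 1 / n) * e"
proof -
  have card: "0 < real (card G)" using assms(1,2) by (auto simp: card_gt_0_iff)
  have e: "0 \<le> e" using assms(3)[OF assms(2)] by simp
  have "sum p G = p u + sum p (G - {u})" using assms(1,2) by (rule sum.remove)
  then have "real (card G) * p u - sum p G = (\<Sum>u'\<in>G - {u}. p u - p u')"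
    using assms(1,2) card by (simp add: sum_subtractf card_Diff_singleton of_nat_diff algebra_simps)
  moreover have "\<bar>\<Sum>u'\<in>G - {u}. p u - p u'\<bar> \<le> (\<Sum>u'\<in>G - {u}. e)"
    by (rule order_trans[OF sum_abs]) (rule sum_mono, use assms(3) in simp)
  ultimately have "\<bar>real (card G) * p u - sum p G\<bar> \<le> (real (card G) - 1) * e"
    using assms(1,2) card by (simp add: card_Diff_singleton of_nat_diff)
  moreover have "p u - sum p G / card G = (real (card G) * p u - sum p G) / card G"
    using card by (simp add: field_simps)
  ultimately have "\<bar>p u - sum p G / card G\<bar> \<le> (1 - 1 / card G) * e"
    using card by (simp add: abs_divide field_simps)
  also have "\<dots> \<le> (1 - 1 / n) * e"
    using e card assms(4) by (intro mult_right_mono) (auto simp: frac_le)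
  finally show ?thesis .
qed

lemma mesh_Sd:
  assumes L: "abstract_complex L" "finite L" and \<sigma>: "\<sigma> \<in> Sd b L" and u: "u \<in> \<sigma>" "u' \<in> \<sigma>"
  shows "\<bar>position u a - position u' a\<bar> \<le> (1 - 1 / card (\<Union>L)) ^ b"
  using \<sigma> u
proof (induction b arbitrary: \<sigma> u u')
  case 0
  then show ?case by (auto simp: Sd_0 vertex_point_def indicator_def)
next
  case (Suc b)
  let ?q = "1 - 1 / real (card (\<Union>L))"
  have *: "\<bar>centroid (fset F) a - centroid (fset G) a\<bar> \<le> ?q ^ Suc b"
    if "fset F \<subseteq> fset G" "fset F \<in> Sd b L" "fset G \<in> Sd b L" for F G :: "'a sd_vertex fset"
    unfolding centroid_def
  proof (rule average_close)
    show "fset F \<noteq> {}" using complex_simplexD(2)[OF abstract_complex_Sd[OF L(1)] that(2)] .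
    fix u assume "u \<in> fset F"
    then show "\<bar>position u a - (\<Sum>u\<in>fset G. position u a) / card (fset G)\<bar> \<le> ?q ^ Suc b"
      unfolding power_Suc using that(1)
      by (intro average_close_to_member Suc.IH[OF that(3)] card_simplex_Sd[OF L that(3)]) auto
  qed simp
  obtain C where C: "\<sigma> = Bary ` C" "subset.chain (Sd b L) (fset ` C)" "\<And>G. G \<in> C \<Longrightarrow> fset G \<in> Sd b L"
    using Sd_Suc_cases[OF Suc.prems(1)] by metis
  obtain F G where FG: "u = Bary F" "u' = Bary G" "F \<in> C" "G \<in> C"
    using Suc.prems(2,3) C(1) by blast
  then have "fset F \<subseteq> fset G \<or> fset G \<subseteq> fset F" using C(2) by (auto simp: subset_chain_def)
  then show ?case
    unfolding FG(1,2) position_Bary using *[of F G] *[of G F] C(3) FG(3,4)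
    by (auto simp: abs_minus_commute)
qed

lemma centroid_near_vertices:
  assumes L: "abstract_complex L" "finite L" and e: "0 < e"
  shows "\<exists>b. \<forall>\<sigma>\<in>Sd b L. \<forall>u\<in>\<sigma>. coordinate_dist (\<Union>L) (centroid \<sigma>) (position u) < e"
proof -
  let ?n = "card (\<Union>L)"
  let ?q = "1 - 1 / real ?n"
  have "\<exists>b. ?n * ?q ^ b < e"
  proof (cases "?n = 0")
    case False
    have "(\<lambda>b. ?n * ?q ^ b) \<longlonglongrightarrow> real ?n * 0"
      using False by (intro tendsto_mult tendsto_const LIMSEQ_power_zero) auto
    then have "eventually (\<lambda>b. ?n * ?q ^ b < e) sequentially"
      using e by (intro order_tendstoD(2)) auto
    then show ?thesis by (auto dest: eventually_happens)
  qed (use e in simp)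
  then obtain b where b: "?n * ?q ^ b < e" by blast
  have "coordinate_dist (\<Union>L) (centroid \<sigma>) (position u) < e" if \<sigma>: "\<sigma> \<in> Sd b L" "u \<in> \<sigma>" for \<sigma> u
  proof -
    have "\<bar>centroid \<sigma> a - position u a\<bar> \<le> ?q ^ b" for a
      unfolding centroid_def
      using complex_simplexD(1,2)[OF abstract_complex_Sd[OF L(1)] \<sigma>(1)] mesh_Sd[OF L \<sigma>(1) _ \<sigma>(2)]
      by (intro average_close)
    then have "coordinate_dist (\<Union>L) (centroid \<sigma>) (position u) \<le> (\<Sum>a\<in>\<Union>L. ?q ^ b)"
      unfolding coordinate_dist_def by (intro sum_mono)
    then show ?thesis using b by simp
  qed
  then show ?thesis by blast
qed


section \<open>From homotopies on open sets to contiguous simplicial maps\<close>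

lemma contiguousI:
  assumes K: "abstract_complex K" and J: "abstract_complex J" and c: "1 \<le> c"
    and ends: "\<And>v. \<psi> 0 v = \<phi> v" "\<And>v. \<psi> c v = \<phi>' v"
    and step: "\<And>\<sigma> i. \<sigma> \<in> J \<Longrightarrow> i < c \<Longrightarrow> \<exists>\<tau>\<in>K. \<psi> i ` \<sigma> \<union> \<psi> (Suc i) ` \<sigma> \<subseteq> \<tau>"
  shows "contiguous c J K \<phi> \<phi>'"
  unfolding contiguous_def
proof (intro exI[of _ \<psi>] conjI ballI allI impI)
  have union: "\<psi> i ` \<sigma> \<union> \<psi> (Suc i) ` \<sigma> \<in> K" "\<psi> i ` \<sigma> \<in> K" "\<psi> (Suc i) ` \<sigma> \<in> K"
    if \<sigma>: "\<sigma> \<in> J" and i: "i < c" for \<sigma> i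
  proof -
    obtain \<tau> where \<tau>: "\<tau> \<in> K" "\<psi> i ` \<sigma> \<subseteq> \<tau>" "\<psi> (Suc i) ` \<sigma> \<subseteq> \<tau>"
      using step[OF \<sigma> i] by auto
    have "\<sigma> \<noteq> {}" using complex_simplexD(2)[OF J \<sigma>] .
    then show "\<psi> i ` \<sigma> \<union> \<psi> (Suc i) ` \<sigma> \<in> K" "\<psi> i ` \<sigma> \<in> K" "\<psi> (Suc i) ` \<sigma> \<in> K"
      using \<tau>(2,3) by (auto intro!: complex_simplexD(3)[OF K \<tau>(1)])
  qed
  show "simplicial_map J K (\<psi> i)" if "i \<le> c" for i
    unfolding simplicial_map_def
  proof
    fix \<sigma> assume \<sigma>: "\<sigma> \<in> J"
    show "\<psi> i ` \<sigma> \<in> K"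
    proof (cases i)
      case 0
      then show ?thesis using union(2)[OF \<sigma>, of 0] c by simp
    next
      case (Suc j)
      then show ?thesis using union(3)[OF \<sigma>, of j] that by simp
    qed
  qed
  show "contiguous1 J K (\<psi> (i - 1)) (\<psi> i)" if "i \<in> {1..c}" for i
    unfolding contiguous1_def using union(1)[of _ "i - 1"] that by (auto simp: facets_def)
qed (use ends in auto)

text \<open>Simplicial approximation of the whole homotopy: the subcomplex for \<open>U\<close> consists of the simplices
  around whose vertices the homotopy on \<open>U\<close> is controlled by stars, and the intermediate maps pick
  such stars at the times \<open>k / N\<close>.\<close>

lemma contiguous_cover_if_homotopic_cover:
  assumes L: "abstract_complex L" "finite L" and K: "abstract_complex K"
    and lam: "selects_vertices L lam"
    and \<U>: "\<Union>\<U> = topspace (realization L)" "\<And>U. U \<in> \<U> \<Longrightarrow> openin (realization L) U"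
    and hom: "\<And>U. U \<in> \<U> \<Longrightarrow> homotopic (subtopology (realization L) U) (realization K)
      (realization_map \<phi>) (realization_map \<phi>')"
  obtains b c J where "\<Union>(J ` \<U>) = Sd b L" "\<And>U. U \<in> \<U> \<Longrightarrow> subcomplex (J U) (Sd b L)"
    "\<And>U. U \<in> \<U> \<Longrightarrow> contiguous c (J U) K (subdivided_map lam \<phi> b) (subdivided_map lam \<phi>' b)"
proof -
  let ?V = "\<Union>L"
  let ?X = "topspace (realization L)"
  let ?d = "coordinate_dist ?V"
  have "\<forall>U\<in>\<U>. \<exists>H. continuous_map (prod_topology (top_of_set {0..1}) (subtopology (realization L) U)) (realization K) H
      \<and> (\<forall>x. H (0::real, x) = realization_map \<phi> x) \<and> (\<forall>x. H (1, x) = realization_map \<phi>' x)"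
    using hom unfolding homotopic_with_def by fastforce
  then obtain H where H: "\<And>U. U \<in> \<U> \<Longrightarrow> continuous_map
      (prod_topology (top_of_set {0..1}) (subtopology (realization L) U)) (realization K) (H U)"
    "\<And>U x. U \<in> \<U> \<Longrightarrow> H U (0::real, x) = realization_map \<phi> x"
    "\<And>U x. U \<in> \<U> \<Longrightarrow> H U (1, x) = realization_map \<phi>' x"
    by metis
  have "\<exists>e>0. \<forall>x\<in>?X. \<exists>U\<in>\<U>. star_controlled L U (H U) x e"
  proof (rule uniform_radius_exists[where d = ?d])
    show "compact_space (realization L)" using compact_space_realization[OF L] .
    show "openin (realization L) {y \<in> ?X. ?d x y < e}" for x e
      using openin_coordinate_ball[OF finite_vertices[OF L]] .
    show "\<exists>e>0. \<exists>U\<in>\<U>. star_controlled L U (H U) x e" if x: "x \<in> ?X" for x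
    proof -
      obtain U where U: "U \<in> \<U>" "x \<in> U" using x \<U>(1) by blast
      then show ?thesis using star_controlled_exists[OF L K \<U>(2) _ H(1)] by blast
    qed
  qed (auto simp: coordinate_dist_def intro: star_controlled_mono[unfolded coordinate_dist_def])
  then obtain e where e: "0 < e" "\<And>x. x \<in> ?X \<Longrightarrow> \<exists>U\<in>\<U>. star_controlled L U (H U) x e"
    by blast
  \<comment> \<open>Half of the radius is spent on the way from the centroid of a simplex to its vertices.\<close>
  define \<delta> where "\<delta> = e / 2"
  have \<delta>: "0 < \<delta>" using e(1) by (simp add: \<delta>_def)
  obtain b where b: "\<And>\<sigma> u. \<sigma> \<in> Sd b L \<Longrightarrow> u \<in> \<sigma> \<Longrightarrow> ?d (centroid \<sigma>) (position u) < \<delta>"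
    using centroid_near_vertices[OF L \<delta>] by blast
  obtain N :: nat where N: "0 < N" "1 / real N < \<delta>"
    using \<delta> by (metis nat_approx_posE zero_less_Suc inverse_eq_divide of_nat_Suc)
  define J where "J U = {\<sigma> \<in> Sd b L. \<forall>u\<in>\<sigma>. star_controlled L U (H U) (position u) \<delta>}" for U
  note Sdb = abstract_complex_Sd[OF L(1), of b]
  have subJ: "subcomplex (J U) (Sd b L)" for U
    unfolding subcomplex_def abstract_complex_def
  proof (intro conjI ballI allI impI)
    show JSd: "J U \<subseteq> Sd b L" by (auto simp: J_def)
    fix \<sigma> assume \<sigma>: "\<sigma> \<in> J U"
    then have "\<sigma> \<in> Sd b L" using JSd by blast
    note simplex = complex_simplexD[OF Sdb this]
    show "finite \<sigma>" "\<sigma> \<noteq> {}" using simplex by simp_all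
    show "\<tau> \<in> J U" if "\<tau> \<noteq> {}" "\<tau> \<subseteq> \<sigma>" for \<tau>
      using \<sigma> simplex(3)[OF that] that(2) by (auto simp: J_def)
  qed
  have cover: "\<Union>(J ` \<U>) = Sd b L"
  proof
    show "Sd b L \<subseteq> \<Union>(J ` \<U>)"
    proof
      fix \<sigma> assume \<sigma>: "\<sigma> \<in> Sd b L"
      obtain U where U: "U \<in> \<U>" "star_controlled L U (H U) (centroid \<sigma>) e"
        using e(2)[OF centroid_in_realization[OF L \<sigma>]] by blast
      have "star_controlled L U (H U) (position u) \<delta>" if "u \<in> \<sigma>" for u
        using b[OF \<sigma> that] by (intro star_controlled_mono[OF _ U(2)]) (simp add: \<delta>_def)
      then show "\<sigma> \<in> \<Union>(J ` \<U>)" using \<sigma> U(1) by (auto simp: J_def)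
    qed
  qed (auto simp: J_def)
  have "contiguous (Suc (Suc N)) (J U) K (subdivided_map lam \<phi> b) (subdivided_map lam \<phi>' b)"
    if U: "U \<in> \<U>" for U
  proof -
    define W where "W k u = (SOME w. \<forall>y\<in>?X. \<forall>s\<in>{0..1}. ?d (position u) y < \<delta> \<longrightarrow>
      \<bar>s - real k / real N\<bar> < \<delta> \<longrightarrow> y \<in> U \<and> 0 < H U (s, y) w)" for k u
    have W: "y \<in> U \<and> 0 < H U (s, y) (W k u)"
      if "star_controlled L U (H U) (position u) \<delta>" "k \<le> N" "y \<in> ?X" "s \<in> {0..1}"
        "?d (position u) y < \<delta>" "\<bar>s - real k / real N\<bar> < \<delta>" for k u y s
    proof -
      have "real k / real N \<in> {0..1}" using that(2) N(1) by simp
      then have "\<exists>w. \<forall>y\<in>?X. \<forall>s\<in>{0..1}. ?d (position u) y < \<delta> \<longrightarrow>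
          \<bar>s - real k / real N\<bar> < \<delta> \<longrightarrow> y \<in> U \<and> 0 < H U (s, y) w"
        using that(1) unfolding star_controlled_def by blast
      then have "\<forall>y\<in>?X. \<forall>s\<in>{0..1}. ?d (position u) y < \<delta> \<longrightarrow>
          \<bar>s - real k / real N\<bar> < \<delta> \<longrightarrow> y \<in> U \<and> 0 < H U (s, y) (W k u)"
        unfolding W_def by (rule someI_ex)
      then show ?thesis using that(3-6) by blast
    qed
    \<comment> \<open>The \<open>N + 1\<close> approximations lie between the two given maps, whence \<open>N + 2\<close> steps.\<close>
    define \<psi> where "\<psi> i = (if i = 0 then subdivided_map lam \<phi> b
      else if i = Suc (Suc N) then subdivided_map lam \<phi>' b else W (i - 1))" for i
    show ?thesis
    proof (rule contiguousI[OF K _ _ , of _ _ \<psi>])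
      show "abstract_complex (J U)" using subJ by (simp add: subcomplex_def)
      fix \<sigma> i assume \<sigma>J: "\<sigma> \<in> J U" and i: "i < Suc (Suc N)"
      have \<sigma>: "\<sigma> \<in> Sd b L" "\<And>u. u \<in> \<sigma> \<Longrightarrow> star_controlled L U (H U) (position u) \<delta>"
        using \<sigma>J by (auto simp: J_def)
      define p where "p = centroid \<sigma>"
      have p: "p \<in> ?X" using centroid_in_realization[OF L \<sigma>(1)] by (simp add: p_def)
      have near: "?d (position u) p < \<delta>" if "u \<in> \<sigma>" for u
        using b[OF \<sigma>(1) that] by (simp add: p_def coordinate_dist_def abs_minus_commute)
      obtain u0 where u0: "u0 \<in> \<sigma>" using complex_simplexD(2)[OF Sdb \<sigma>(1)] by blast
      have pU: "p \<in> U" using W[OF \<sigma>(2)[OF u0] _ p _ near[OF u0], of 0 0] \<delta> by simp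
      have HK: "H U (s, p) \<in> topspace (realization K)" if "s \<in> {0..1}" for s
        using H(1)[OF U] that p pU by (simp add: continuous_map_into_realization)
      have Wsupp: "W k ` \<sigma> \<subseteq> support (H U (s, p))"
        if "s \<in> {0..1}" "k \<le> N" "\<bar>s - real k / real N\<bar> < \<delta>" for s k
      proof
        fix w assume "w \<in> W k ` \<sigma>"
        then obtain u where u: "u \<in> \<sigma>" "w = W k u" by blast
        have "0 < H U (s, p) w"
          using W[OF \<sigma>(2)[OF u(1)] that(2) p that(1) near[OF u(1)] that(3)] u(2) by simp
        then show "w \<in> support (H U (s, p))" by (simp add: support_def)
      qed
      have ends: "subdivided_map lam f b ` \<sigma> \<subseteq> support (realization_map f p)" for f :: "'a \<Rightarrow> 'b"
      proof -
        have "subdivided_map lam id b ` \<sigma> \<subseteq> support p"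
          using selected_vertex_in_support_position[OF lam, of _ b] \<sigma>(1)
            complex_simplexD(1)[OF Sdb \<sigma>(1)] by (auto simp: p_def support_centroid)
        then show ?thesis
          unfolding support_realization_map[OF L(1) p] subdivided_map_eq[of lam f] by auto
      qed
      \<comment> \<open>At this time both \<open>\<psi> i\<close> and \<open>\<psi> (Suc i)\<close> map \<open>\<sigma>\<close> into the simplex that carries \<open>H U (s, p)\<close>.\<close>
      define s where "s = (if i = Suc N then 1 else real i / real N)"
      have s: "s \<in> {0..1}" using i N(1) by (auto simp: s_def)
      have "\<psi> i ` \<sigma> \<subseteq> support (H U (s, p))"
      proof (cases i)
        case 0
        then show ?thesis using ends[of \<phi>] H(2)[OF U] by (simp add: \<psi>_def s_def)
      next
        case (Suc k)
        have "\<bar>s - real k / real N\<bar> < \<delta>"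
          using N \<delta> i Suc by (auto simp: s_def add_divide_distrib)
        then show ?thesis using Wsupp[OF s, of k] i Suc by (simp add: \<psi>_def)
      qed
      moreover have "\<psi> (Suc i) ` \<sigma> \<subseteq> support (H U (s, p))"
      proof (cases "i = Suc N")
        case True
        then show ?thesis using ends[of \<phi>'] H(3)[OF U] by (simp add: \<psi>_def s_def)
      next
        case False
        then show ?thesis using Wsupp[OF s, of i] i \<delta> by (simp add: \<psi>_def s_def)
      qed
      ultimately show "\<exists>\<tau>\<in>K. \<psi> i ` \<sigma> \<union> \<psi> (Suc i) ` \<sigma> \<subseteq> \<tau>"
        using realization_memberD(2)[OF HK[OF s]] by blast
    qed (simp_all add: \<psi>_def)
  qed
  then show ?thesis by (rule that[OF cover subJ])
qed

section \<open>The contiguity distance as a homotopic distance\<close>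

definition homotopic_distance :: "'a topology \<Rightarrow> 'b topology \<Rightarrow> ('a \<Rightarrow> 'b) \<Rightarrow> ('a \<Rightarrow> 'b) \<Rightarrow> enat" where
  "homotopic_distance X Y f g =
     Inf {enat (card \<U>) | \<U>. finite \<U> \<and> \<Union>\<U> = topspace X \<and>
        (\<forall>U\<in>\<U>. openin X U \<and> homotopic (subtopology X U) Y f g)} - 1"

lemma enat_minus_one_mono: "a \<le> b \<Longrightarrow> a - 1 \<le> (b - 1 :: enat)"
  by (cases a; cases b) (auto simp: one_enat_def)

text \<open>An infimum of extended natural numbers is attained, unless the set is empty and both sides are
  infinite.\<close>

lemma enat_le_Inf_minus_one:
  fixes A :: "enat set"
  assumes "\<And>a. a \<in> A \<Longrightarrow> D \<le> a - 1"
  shows "D \<le> Inf A - 1"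
proof (cases "A = {}")
  case False
  then have "Inf A \<in> A" unfolding Inf_enat_def by (auto intro: LeastI)
  then show ?thesis by (rule assms)
qed (simp add: Inf_enat_def)

lemma homotopic_distance_le:
  assumes "finite \<U>" "\<Union>\<U> = topspace X" "\<And>U. U \<in> \<U> \<Longrightarrow> openin X U"
    "\<And>U. U \<in> \<U> \<Longrightarrow> homotopic (subtopology X U) Y f g" "card \<U> \<le> n"
  shows "homotopic_distance X Y f g \<le> enat n - 1"
proof -
  have "homotopic_distance X Y f g \<le> enat (card \<U>) - 1"
    unfolding homotopic_distance_def
    by (rule enat_minus_one_mono, rule Inf_lower) (use assms in blast)
  also have "\<dots> \<le> enat n - 1" using assms(5) by (intro enat_minus_one_mono) simp
  finally show ?thesis .
qed

lemma le_homotopic_distance: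
  assumes "\<And>\<U>. \<lbrakk>finite \<U>; \<Union>\<U> = topspace X; \<And>U. U \<in> \<U> \<Longrightarrow> openin X U;
    \<And>U. U \<in> \<U> \<Longrightarrow> homotopic (subtopology X U) Y f g\<rbrakk> \<Longrightarrow> D \<le> enat (card \<U>) - 1"
  shows "D \<le> homotopic_distance X Y f g"
  unfolding homotopic_distance_def by (rule enat_le_Inf_minus_one) (use assms in blast)

lemma homotopic_distance_pullback:
  assumes q: "continuous_map X' X q"
    and f: "homotopic X' Y (f \<circ> q) f'" and g: "homotopic X' Y (g \<circ> q) g'"
  shows "homotopic_distance X' Y f' g' \<le> homotopic_distance X Y f g"
proof (rule le_homotopic_distance)
  fix \<U> assume \<U>: "finite \<U>" "\<Union>\<U> = topspace X" "\<And>U. U \<in> \<U> \<Longrightarrow> openin X U"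
    "\<And>U. U \<in> \<U> \<Longrightarrow> homotopic (subtopology X U) Y f g"
  define P where "P U = {x \<in> topspace X'. q x \<in> U}" for U
  show "homotopic_distance X' Y f' g' \<le> enat (card \<U>) - 1"
  proof (rule homotopic_distance_le)
    show "\<Union>(P ` \<U>) = topspace X'"
      using \<U>(2) continuous_map_image_subset_topspace[OF q] by (fastforce simp: P_def)
    show "openin X' V" if V: "V \<in> P ` \<U>" for V
    proof -
      obtain U where U: "U \<in> \<U>" "V = P U" using V by blast
      show ?thesis unfolding U(2) P_def by (rule openin_continuous_map_preimage[OF q \<U>(3)[OF U(1)]])
    qed
    show "homotopic (subtopology X' V) Y f' g'" if V: "V \<in> P ` \<U>" for V
    proof -
      obtain U where U: "U \<in> \<U>" "V = P U" using V by blast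
      have "continuous_map (subtopology X' V) (subtopology X U) q"
        using q by (auto simp: U(2) P_def continuous_map_in_subtopology continuous_map_from_subtopology)
      then have "homotopic (subtopology X' V) Y (f \<circ> q) (g \<circ> q)"
        by (rule homotopic_with_compose_continuous_map_right[OF \<U>(4)[OF U(1)]]) simp
      then show ?thesis
        using homotopic_from_subtopology[OF f, of V] homotopic_from_subtopology[OF g, of V]
        by (meson homotopic_with_symD homotopic_with_trans)
    qed
  qed (use \<U>(1) card_image_le in auto)
qed

lemma contiguous_Suc:
  assumes "contiguous c J K \<phi> \<phi>'"
  shows "contiguous (Suc c) J K \<phi> \<phi>'"
proof -
  obtain \<psi> where \<psi>: "\<forall>v\<in>\<Union>J. \<psi> 0 v = \<phi> v" "\<forall>v\<in>\<Union>J. \<psi> c v = \<phi>' v"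
    "\<forall>i\<le>c. simplicial_map J K (\<psi> i)"
    "\<forall>i\<in>{1..c}. contiguous1 J K (\<psi> (i - 1)) (\<psi> i)"
    using assms unfolding contiguous_def by blast
  have refl: "contiguous1 J K (\<psi> c) (\<psi> c)"
    using \<psi>(3) by (auto simp: contiguous1_def simplicial_map_def facets_def)
  have "contiguous1 J K (\<psi> (min c (i - 1))) (\<psi> (min c i))" if "i \<in> {1..Suc c}" for i
  proof (cases "i \<le> c")
    case True
    then have "min c i = i" "min c (i - 1) = i - 1" by simp_all
    then show ?thesis using \<psi>(4) True that by simp
  next
    case False
    then show ?thesis using refl that by simp
  qed
  then show ?thesis
    unfolding contiguous_def
    by (intro exI[of _ "\<lambda>i. \<psi> (min c i)"]) (use \<psi>(1-3) in auto)
qed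

lemma contiguous_compose:
  assumes K: "abstract_complex K" and J: "finite J"
    and con: "contiguous c J K \<phi> \<phi>'" and f: "simplicial_map J' J f"
  shows "contiguous c J' K (\<phi> \<circ> f) (\<phi>' \<circ> f)"
proof -
  obtain \<psi> where \<psi>: "\<forall>v\<in>\<Union>J. \<psi> 0 v = \<phi> v" "\<forall>v\<in>\<Union>J. \<psi> c v = \<phi>' v"
    "\<forall>i\<le>c. simplicial_map J K (\<psi> i)"
    "\<forall>i\<in>{1..c}. contiguous1 J K (\<psi> (i - 1)) (\<psi> i)"
    using con unfolding contiguous_def by blast
  have fv: "f v \<in> \<Union>J" if "v \<in> \<Union>J'" for v
    using that f by (auto simp: simplicial_map_def)
  show ?thesis
    unfolding contiguous_def
  proof (intro exI[of _ "\<lambda>i. \<psi> i \<circ> f"] conjI ballI allI impI)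
    show "simplicial_map J' K (\<psi> i \<circ> f)" if "i \<le> c" for i
      using \<psi>(3) that simplicial_map_compose[OF f] by blast
    show "contiguous1 J' K (\<psi> (i - 1) \<circ> f) (\<psi> i \<circ> f)" if i: "i \<in> {1..c}" for i
      unfolding contiguous1_def
    proof
      fix \<sigma> assume "\<sigma> \<in> facets J'"
      then have f\<sigma>: "f ` \<sigma> \<in> J" using f by (simp add: facets_def simplicial_map_def)
      obtain \<tau> where \<tau>: "\<tau> \<in> K" "\<psi> (i - 1) ` f ` \<sigma> \<union> \<psi> i ` f ` \<sigma> \<subseteq> \<tau>"
        using contiguous_common_simplex[OF K J _ f\<sigma>] \<psi>(4) i by blast
      have "\<psi> i ` f ` \<sigma> \<in> K" using \<psi>(3) i f\<sigma> by (simp add: simplicial_map_def)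
      then have "f ` \<sigma> \<noteq> {}" using complex_simplexD(2)[OF K] by blast
      then show "(\<psi> (i - 1) \<circ> f) ` \<sigma> \<union> (\<psi> i \<circ> f) ` \<sigma> \<in> K"
        unfolding image_comp[symmetric] by (intro complex_simplexD(3)[OF K \<tau>(1) _ \<tau>(2)]) simp
    qed
    show "(\<psi> 0 \<circ> f) v = (\<phi> \<circ> f) v" "(\<psi> c \<circ> f) v = (\<phi>' \<circ> f) v" if "v \<in> \<Union>J'" for v
      using \<psi>(1)[rule_format, OF fv[OF that]] \<psi>(2)[rule_format, OF fv[OF that]] by simp_all
  qed
qed

lemma strict_contiguity_distance_at_le:
  assumes "finite \<J>" "\<Union>\<J> = L" "\<And>J. J \<in> \<J> \<Longrightarrow> subcomplex J L"
    "\<And>J. J \<in> \<J> \<Longrightarrow> contiguous c J K \<phi> \<phi>'" "card \<J> \<le> n"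
  shows "strict_contiguity_distance_at c L K \<phi> \<phi>' \<le> enat n - 1"
proof -
  have "strict_contiguity_distance_at c L K \<phi> \<phi>' \<le> enat (card \<J>) - 1"
    unfolding strict_contiguity_distance_at_def
    by (rule enat_minus_one_mono, rule Inf_lower) (use assms in blast)
  also have "\<dots> \<le> enat n - 1" using assms(5) by (intro enat_minus_one_mono) simp
  finally show ?thesis .
qed

lemma le_strict_contiguity_distance_at:
  assumes "\<And>\<J>. \<lbrakk>finite \<J>; \<Union>\<J> = L; \<And>J. J \<in> \<J> \<Longrightarrow> subcomplex J L;
    \<And>J. J \<in> \<J> \<Longrightarrow> contiguous c J K \<phi> \<phi>'\<rbrakk> \<Longrightarrow> D \<le> enat (card \<J>) - 1"
  shows "D \<le> strict_contiguity_distance_at c L K \<phi> \<phi>'"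
  unfolding strict_contiguity_distance_at_def by (rule enat_le_Inf_minus_one) (use assms in blast)

lemma strict_contiguity_distance_eq_INF:
  "strict_contiguity_distance L K \<phi> \<phi>' = (INF c. strict_contiguity_distance_at c L K \<phi> \<phi>')"
proof -
  have "decseq (\<lambda>c. strict_contiguity_distance_at c L K \<phi> \<phi>')"
    unfolding decseq_Suc_iff
    by (intro allI le_strict_contiguity_distance_at strict_contiguity_distance_at_le contiguous_Suc) auto
  then show ?thesis
    unfolding strict_contiguity_distance_def by (intro limI LIMSEQ_INF)
qed

lemma subcomplex_preimage:
  assumes J: "abstract_complex J" and M: "abstract_complex M"
  shows "subcomplex {\<sigma> \<in> M. f ` \<sigma> \<in> J} M"
  unfolding subcomplex_def abstract_complex_def
proof (intro conjI ballI allI impI)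
  fix \<sigma> assume \<sigma>: "\<sigma> \<in> {\<sigma> \<in> M. f ` \<sigma> \<in> J}"
  show "finite \<sigma>" "\<sigma> \<noteq> {}" using \<sigma> complex_simplexD[OF M] by blast+
  show "\<tau> \<in> {\<sigma> \<in> M. f ` \<sigma> \<in> J}" if "\<tau> \<noteq> {}" "\<tau> \<subseteq> \<sigma>" for \<tau>
    using \<sigma> that complex_simplexD(3)[OF M _ that] complex_simplexD(3)[OF J, of "f ` \<sigma>" "f ` \<tau>"]
    by (simp add: image_mono)
qed blast

text \<open>The sequence in \<open>b\<close> is decreasing because covers of \<open>Sd b L\<close> are pulled back along the simplicial map
  \<open>lam (Suc b)\<close>; in \<open>enat\<close> its limit is its infimum.\<close>

lemma contiguity_distance_eq_INF:
  assumes L: "abstract_complex L" "finite L" and K: "abstract_complex K"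
    and lam: "identity_approximations L lam"
  shows "contiguity_distance lam L K \<phi> \<phi>' = (INF b. INF c. strict_contiguity_distance_at c (Sd b L) K
    (subdivided_map lam \<phi> b) (subdivided_map lam \<phi>' b))"
proof -
  let ?D = "\<lambda>b c. strict_contiguity_distance_at c (Sd b L) K
    (subdivided_map lam \<phi> b) (subdivided_map lam \<phi>' b)"
  have "?D (Suc b) c \<le> ?D b c" for b c
  proof (rule le_strict_contiguity_distance_at)
    fix \<J> assume \<J>: "finite \<J>" "\<Union>\<J> = Sd b L" "\<And>J. J \<in> \<J> \<Longrightarrow> subcomplex J (Sd b L)"
      "\<And>J. J \<in> \<J> \<Longrightarrow> contiguous c J K (subdivided_map lam \<phi> b) (subdivided_map lam \<phi>' b)"
    define P where "P J = {\<sigma> \<in> Sd (Suc b) L. lam (Suc b) ` \<sigma> \<in> J}" for J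
    show "?D (Suc b) c \<le> enat (card \<J>) - 1"
    proof (rule strict_contiguity_distance_at_le)
      show "\<Union>(P ` \<J>) = Sd (Suc b) L"
        using identity_approximations_simplicial[OF lam, of b] \<J>(2)
        by (auto simp: P_def simplicial_map_def)
      show "subcomplex J (Sd (Suc b) L)" if "J \<in> P ` \<J>" for J
        using that \<J>(3) unfolding P_def
        by (auto simp: subcomplex_def[of _ "Sd b L"] intro!: subcomplex_preimage abstract_complex_Sd[OF L(1)])
      show "contiguous c J' K (subdivided_map lam \<phi> (Suc b)) (subdivided_map lam \<phi>' (Suc b))"
        if J': "J' \<in> P ` \<J>" for J'
      proof -
        obtain J where J: "J \<in> \<J>" "J' = P J" using J' by blast
        have "finite J"
          using \<J>(3)[OF J(1)] finite_Sd[OF L(2)] finite_subset unfolding subcomplex_def by blast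
        moreover have "simplicial_map J' J (lam (Suc b))"
          by (simp add: J(2) P_def simplicial_map_def)
        ultimately show ?thesis
          unfolding subdivided_map.simps by (intro contiguous_compose[OF K _ \<J>(4)[OF J(1)]])
      qed
    qed (use \<J>(1) card_image_le in auto)
  qed
  then have "decseq (\<lambda>b. INF c. ?D b c)"
    unfolding decseq_Suc_iff by (intro allI INF_mono) auto
  then show ?thesis
    unfolding contiguity_distance_def strict_contiguity_distance_eq_INF by (intro limI LIMSEQ_INF)
qed

theorem contiguity_distance_eq_homotopic_distance:
  assumes L: "abstract_complex L" "finite L" and K: "abstract_complex K"
    and lam: "identity_approximations L lam"
    and \<phi>: "simplicial_map L K \<phi>" "simplicial_map L K \<phi>'"
  shows "contiguity_distance lam L K \<phi> \<phi>' =
    homotopic_distance (realization L) (realization K) (realization_map \<phi>) (realization_map \<phi>')"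
    (is "?D = ?H")
proof (rule antisym)
  note sel = identity_approximations_select_vertices[OF L(1) lam]
  note D = contiguity_distance_eq_INF[OF L K lam, of \<phi> \<phi>']
  show "?D \<le> ?H"
  proof (rule le_homotopic_distance)
    fix \<U> assume \<U>: "finite \<U>" "\<Union>\<U> = topspace (realization L)" "\<And>U. U \<in> \<U> \<Longrightarrow> openin (realization L) U"
      "\<And>U. U \<in> \<U> \<Longrightarrow> homotopic (subtopology (realization L) U) (realization K)
         (realization_map \<phi>) (realization_map \<phi>')"
    show "?D \<le> enat (card \<U>) - 1"
    proof (rule contiguous_cover_if_homotopic_cover[OF L K sel \<U>(2)])
      fix b c J assume J: "\<Union>(J ` \<U>) = Sd b L" "\<And>U. U \<in> \<U> \<Longrightarrow> subcomplex (J U) (Sd b L)"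
        "\<And>U. U \<in> \<U> \<Longrightarrow> contiguous c (J U) K (subdivided_map lam \<phi> b) (subdivided_map lam \<phi>' b)"
      have "strict_contiguity_distance_at c (Sd b L) K
          (subdivided_map lam \<phi> b) (subdivided_map lam \<phi>' b) \<le> enat (card \<U>) - 1"
        by (rule strict_contiguity_distance_at_le[of "J ` \<U>"])
          (use J \<U>(1) card_image_le in auto)
      then show "?D \<le> enat (card \<U>) - 1"
        unfolding D by (intro INF_lower2[of b] INF_lower2[of c]) simp_all
    qed (fact \<U>(3,4))+
  qed
  show "?H \<le> ?D"
    unfolding D
  proof (intro INF_greatest le_strict_contiguity_distance_at)
    fix b c \<J> assume \<J>: "finite \<J>" "\<Union>\<J> = Sd b L" "\<And>J. J \<in> \<J> \<Longrightarrow> subcomplex J (Sd b L)"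
      "\<And>J. J \<in> \<J> \<Longrightarrow> contiguous c J K (subdivided_map lam \<phi> b) (subdivided_map lam \<phi>' b)"
    obtain h where h: "continuous_map (realization L) (realization (Sd b L)) h"
      "\<And>x. x \<in> topspace (realization L) \<Longrightarrow> subdivided_map lam id b ` support (h x) \<subseteq> support x"
      using map_to_iterated_subdivision_exists[OF L sel, of b] by blast
    have "\<forall>J\<in>\<J>. \<exists>U. openin (realization L) U \<and>
        (\<forall>x\<in>topspace (realization L). h x \<in> topspace (realization J) \<longrightarrow> x \<in> U) \<and>
        homotopic (subtopology (realization L) U) (realization K) (realization_map \<phi>) (realization_map \<phi>')"
      by (intro ballI homotopic_on_open_set_if_contiguous[where c = c, OF L K \<phi> _ _ _ h] \<J>(3,4)
          simplicial_subdivided_map[OF lam])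
    then obtain U where U: "\<And>J. J \<in> \<J> \<Longrightarrow> openin (realization L) (U J)"
      "\<And>J x. \<lbrakk>J \<in> \<J>; x \<in> topspace (realization L); h x \<in> topspace (realization J)\<rbrakk> \<Longrightarrow> x \<in> U J"
      "\<And>J. J \<in> \<J> \<Longrightarrow> homotopic (subtopology (realization L) (U J)) (realization K)
         (realization_map \<phi>) (realization_map \<phi>')"
      by metis
    show "?H \<le> enat (card \<J>) - 1"
    proof (rule homotopic_distance_le)
      show "\<Union>(U ` \<J>) = topspace (realization L)"
      proof
        show "\<Union>(U ` \<J>) \<subseteq> topspace (realization L)"
          using U(1) openin_subset by blast
        show "topspace (realization L) \<subseteq> \<Union>(U ` \<J>)"
        proof
          fix x assume x: "x \<in> topspace (realization L)"
          then have hx: "h x \<in> topspace (realization (Sd b L))"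
            using h(1) by (simp add: continuous_map_into_realization)
          then obtain J where J: "J \<in> \<J>" "support (h x) \<in> J"
            using \<J>(2) realization_memberD(2) by blast
          then have "h x \<in> topspace (realization J)"
            using hx by (simp add: realization_iff)
          then show "x \<in> \<Union>(U ` \<J>)" using U(2)[OF J(1) x] J(1) by blast
        qed
      qed
    qed (use U(1,3) \<J>(1) card_image_le in auto)
  qed
qed

section \<open>Sections of the end-point map as homotopies\<close>

text \<open>The exponential law for the compact interval: evaluation of paths is continuous since the interval
  is locally compact, and the tube lemma gives the continuity of the adjoint of a homotopy.\<close>

lemma section_iff_homotopic:
  "(\<exists>s. continuous_map Z (path_space X) s \<and> (\<forall>p\<in>topspace Z. endpoints (s p) = (f p, g p))) \<longleftrightarrow>
   homotopic Z X f g"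
proof
  let ?I = "top_of_set {0..1::real}"
  let ?G = "\<lambda>C U. {\<gamma> \<in> extensional {0..1}. pathin X \<gamma> \<and> \<gamma> ` C \<subseteq> U}"
  assume "\<exists>s. continuous_map Z (path_space X) s \<and> (\<forall>p\<in>topspace Z. endpoints (s p) = (f p, g p))"
  then obtain s where s: "continuous_map Z (path_space X) s"
    "\<And>p. p \<in> topspace Z \<Longrightarrow> s p 0 = f p \<and> s p 1 = g p"
    by (auto simp: endpoints_def)
  have path: "continuous_map ?I X (s p)" "s p \<in> extensional {0..1}" if p: "p \<in> topspace Z" for p
  proof -
    have "s p \<in> topspace (path_space X)"
      using continuous_map_image_subset_topspace[OF s(1)] p by blast
    then show "continuous_map ?I X (s p)" "s p \<in> extensional {0..1}"
      by (auto simp: path_space_def pathin_def)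
  qed
  have gen: "openin Z {p \<in> topspace Z. s p ` C \<subseteq> V}"
    if "compact C" "C \<subseteq> {0..1}" "openin X V" for C V
  proof -
    have "openin (path_space X) (?G C V)"
      unfolding path_space_def by (rule topology_generated_by_Basis) (use that in blast)
    then have "openin Z {p \<in> topspace Z. s p \<in> ?G C V}"
      by (rule openin_continuous_map_preimage[OF s(1)])
    moreover have "{p \<in> topspace Z. s p \<in> ?G C V} = {p \<in> topspace Z. s p ` C \<subseteq> V}"
      using path by (auto simp: pathin_def)
    ultimately show ?thesis by simp
  qed
  have "continuous_map (prod_topology ?I Z) X (\<lambda>(t, p). s p t)"
    unfolding continuous_map_def
  proof (intro conjI allI impI)
    show "(\<lambda>(t, p). s p t) \<in> topspace (prod_topology ?I Z) \<rightarrow> topspace X"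
      using continuous_map_image_subset_topspace[OF path(1)] by fastforce
    fix V assume V: "openin X V"
    let ?P = "{q \<in> topspace (prod_topology ?I Z). (case q of (t, p) \<Rightarrow> s p t) \<in> V}"
    show "openin (prod_topology ?I Z) ?P"
      unfolding openin_prod_topology_alt
    proof (intro allI impI)
      fix t p assume "(t, p) \<in> ?P"
      then have tp: "t \<in> {0..1}" "p \<in> topspace Z" "s p t \<in> V" by auto
      have "openin ?I {t \<in> topspace ?I. s p t \<in> V}"
        by (rule openin_continuous_map_preimage[OF path(1)[OF tp(2)] V])
      then obtain e where e: "e > 0" "\<And>t'. t' \<in> {0..1} \<Longrightarrow> \<bar>t' - t\<bar> < e \<Longrightarrow> s p t' \<in> V"
        using tp unfolding openin_euclidean_subtopology_iff by (auto simp: dist_real_def)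
      \<comment> \<open>A closed interval around \<open>t\<close>, so that it may serve as compact set.\<close>
      define C where "C = {0..1} \<inter> cball t (e / 2)"
      define A where "A = {0..1} \<inter> ball t (e / 2)"
      have "openin ?I A" by (simp add: A_def openin_open_Int)
      moreover have "openin Z {p \<in> topspace Z. s p ` C \<subseteq> V}"
        by (rule gen[OF _ _ V]) (auto simp: C_def compact_Int_closed)
      moreover have "t \<in> A" using tp(1) e(1) by (simp add: A_def)
      moreover have "p \<in> {p \<in> topspace Z. s p ` C \<subseteq> V}"
      proof -
        have "s p t' \<in> V" if "t' \<in> C" for t'
          using that e by (auto simp: C_def dist_real_def abs_minus_commute)
        then show ?thesis using tp(2) by blast
      qed
      moreover have "A \<times> {p \<in> topspace Z. s p ` C \<subseteq> V} \<subseteq> ?P"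
        by (auto simp: A_def C_def less_imp_le)
      ultimately show "\<exists>U W. openin ?I U \<and> openin Z W \<and> t \<in> U \<and> p \<in> W \<and> U \<times> W \<subseteq> ?P"
        by blast
    qed
  qed
  then have "homotopic Z X (\<lambda>p. s p 0) (\<lambda>p. s p 1)"
    unfolding homotopic_with_def by (intro exI[of _ "\<lambda>(t, p). s p t"]) simp
  then show "homotopic Z X f g"
    by (rule homotopic_with_eq) (use s(2) in auto)
next
  let ?I = "top_of_set {0..1::real}"
  let ?G = "\<lambda>C U. {\<gamma> \<in> extensional {0..1}. pathin X \<gamma> \<and> \<gamma> ` C \<subseteq> U}"
  assume "homotopic Z X f g"
  then obtain h where h: "continuous_map (prod_topology ?I Z) X h"
    "\<And>p. h (0, p) = f p" "\<And>p. h (1, p) = g p"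
    unfolding homotopic_with_def by auto
  define s where "s p = restrict (\<lambda>t. h (t, p)) {0..1::real}" for p
  have path: "pathin X (s p)" if p: "p \<in> topspace Z" for p
  proof -
    have "continuous_map ?I X (h \<circ> (\<lambda>t. (t, p)))"
      by (rule continuous_map_compose[OF _ h(1)]) (use p in \<open>simp add: continuous_map_pairwise o_def\<close>)
    then show ?thesis
      unfolding pathin_def by (rule continuous_map_eq) (simp add: s_def)
  qed
  have "continuous_map Z (path_space X) s"
    unfolding path_space_def continuous_on_generated_topo_iff
  proof (intro conjI allI impI)
    have "s p \<in> ?G {} (topspace X)" if "p \<in> topspace Z" for p
      using path[OF that] by (simp add: s_def)
    then show "s ` topspace Z \<subseteq> \<Union>{?G C U |C U. compact C \<and> C \<subseteq> {0..1} \<and> openin X U}"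
      by (fastforce intro!: exI[of _ "?G {} (topspace X)"])
    fix O' assume "O' \<in> {?G C U |C U. compact C \<and> C \<subseteq> {0..1} \<and> openin X U}"
    then obtain C V where CV: "O' = ?G C V" "compact C" "C \<subseteq> {0..1}" "openin X V" by blast
    let ?W = "{q \<in> topspace (prod_topology ?I Z). h q \<in> V}"
    have W: "openin (prod_topology ?I Z) ?W"
      by (rule openin_continuous_map_preimage[OF h(1) CV(4)])
    have C: "compactin ?I C" using CV(2,3) by (simp add: compactin_subtopology)
    have mem: "p \<in> s -` O' \<inter> topspace Z \<longleftrightarrow> p \<in> topspace Z \<and> C \<times> {p} \<subseteq> ?W" for p
      using path CV(3) by (auto simp: CV(1) s_def subset_iff)
    show "openin Z (s -` O' \<inter> topspace Z)"
    proof (subst openin_subopen, intro ballI)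
      fix p assume "p \<in> s -` O' \<inter> topspace Z"
      then have p: "p \<in> topspace Z" "C \<times> {p} \<subseteq> ?W" using mem by blast+
      obtain A B where AB: "openin Z B" "C \<subseteq> A" "p \<in> B" "A \<times> B \<subseteq> ?W"
        using tube_lemma_left[OF W C p] by blast
      have "B \<subseteq> topspace Z" using AB(1) openin_subset by blast
      then have "B \<subseteq> s -` O' \<inter> topspace Z" using AB(2,4) mem by blast
      then show "\<exists>T. openin Z T \<and> p \<in> T \<and> T \<subseteq> s -` O' \<inter> topspace Z"
        using AB(1,3) by blast
    qed
  qed
  moreover have "endpoints (s p) = (f p, g p)" for p
    by (simp add: endpoints_def s_def h(2,3))
  ultimately show "\<exists>s. continuous_map Z (path_space X) s \<and> (\<forall>p\<in>topspace Z. endpoints (s p) = (f p, g p))"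
    by blast
qed

lemma topological_complexity_eq_homotopic_distance:
  "topological_complexity X = homotopic_distance (prod_topology X X) X fst snd"
proof -
  have "(\<exists>s. continuous_map (subtopology (prod_topology X X) U) (path_space X) s \<and> (\<forall>p\<in>U. endpoints (s p) = p))
      \<longleftrightarrow> homotopic (subtopology (prod_topology X X) U) X fst snd"
    if "openin (prod_topology X X) U" for U
  proof -
    have "topspace (subtopology (prod_topology X X) U) = U"
      using openin_subset[OF that] by (simp add: inf_absorb2)
    then show ?thesis
      using section_iff_homotopic[of "subtopology (prod_topology X X) U" X fst snd] by simp
  qed
  then show ?thesis
    unfolding topological_complexity_def homotopic_distance_def
    by (intro arg_cong[where f = "\<lambda>S. Inf S - 1"] Collect_cong ex_cong1 conj_cong refl ball_cong) blast
qed

section \<open>The ordered square\<close>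

lemma sorted_list_of_chain:
  assumes "finite S" "trans R" "\<And>x y. x \<in> S \<Longrightarrow> y \<in> S \<Longrightarrow> (x, y) \<in> R \<or> (y, x) \<in> R"
  shows "\<exists>ps. set ps = S \<and> sorted_wrt (\<lambda>x y. (x, y) \<in> R) ps"
  using assms(1,3)
proof (induction S)
  case (insert x S)
  then obtain ps where ps: "set ps = S" "sorted_wrt (\<lambda>x y. (x, y) \<in> R) ps" by blast
  let ?qs = "filter (\<lambda>y. (y, x) \<in> R) ps @ x # filter (\<lambda>y. (y, x) \<notin> R) ps"
  have "(x, z) \<in> R" if "z \<in> S" "(z, x) \<notin> R" for z using that insert.prems[of x z] by blast
  then have "sorted_wrt (\<lambda>x y. (x, y) \<in> R) ?qs"
    using ps transD[OF assms(2)] by (auto simp: sorted_wrt_append sorted_wrt_filter)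
  moreover have "set ?qs = insert x S" using ps(1) by auto
  ultimately show ?case by blast
qed simp

lemma ordered_squareI:
  assumes K: "abstract_complex K" and r: "trans r"
    and S: "S \<noteq> {}" "finite S" "fst ` S \<in> K" "snd ` S \<in> K"
    and chain: "\<And>p q. p \<in> S \<Longrightarrow> q \<in> S \<Longrightarrow>
      (fst p, fst q) \<in> r \<and> (snd p, snd q) \<in> r \<or> (fst q, fst p) \<in> r \<and> (snd q, snd p) \<in> r"
  shows "S \<in> ordered_square r K"
proof -
  let ?R = "{(p, q). (fst p, fst q) \<in> r \<and> (snd p, snd q) \<in> r}"
  have "trans ?R" using r by (auto intro!: transI dest: transD)
  then obtain ps where ps: "set ps = S" "sorted_wrt (\<lambda>p q. (p, q) \<in> ?R) ps"
    using sorted_list_of_chain[OF S(2), of ?R] chain by fastforce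
  then have "sorted_wrt (\<lambda>v v'. (v, v') \<in> r) (map fst ps)" "sorted_wrt (\<lambda>w w'. (w, w') \<in> r) (map snd ps)"
    unfolding sorted_wrt_map by (auto elim: sorted_wrt_mono_rel[rotated])
  then show ?thesis
    unfolding ordered_square_def using ps(1) S by (intro CollectI exI[of _ ps]) auto
qed

lemma ordered_square_projections:
  assumes "S \<in> ordered_square r K"
  shows "fst ` S \<in> K" "snd ` S \<in> K"
  using assms by (auto simp: ordered_square_def)

lemma finite_ordered_square:
  assumes "abstract_complex K" "finite K"
  shows "finite (ordered_square r K)"
proof -
  have "ordered_square r K \<subseteq> Pow (\<Union>K \<times> \<Union>K)"
  proof (intro subsetI PowI)
    fix S p assume S: "S \<in> ordered_square r K" "p \<in> S"
    then have "fst p \<in> \<Union>K" "snd p \<in> \<Union>K"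
      using ordered_square_projections[OF S(1)] by blast+
    then show "p \<in> \<Union>K \<times> \<Union>K" by (simp add: mem_Times_iff)
  qed
  then show ?thesis using finite_vertices[OF assms] by (meson finite_Pow_iff finite_SigmaI finite_subset)
qed

text \<open>Lay out the coordinates of a point as consecutive intervals, in the order of the vertices.
  Two points are then coupled by the lengths of the overlaps of their intervals: the pairs of
  vertices whose intervals overlap form a chain.\<close>

definition coordinates_below :: "'a rel \<Rightarrow> 'a set \<Rightarrow> ('a \<Rightarrow> real) \<Rightarrow> 'a \<Rightarrow> real" where
  "coordinates_below r V x v = (\<Sum>u | u \<in> V \<and> (u, v) \<in> r \<and> u \<noteq> v. x u)"

definition overlap :: "'a rel \<Rightarrow> 'a set \<Rightarrow> ('a \<Rightarrow> real) \<Rightarrow> ('a \<Rightarrow> real) \<Rightarrow> 'a \<times> 'a \<Rightarrow> real" where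
  "overlap r V x y = (\<lambda>(v, w). if v \<in> V \<and> w \<in> V then
     max 0 (min (coordinates_below r V x v + x v) (coordinates_below r V y w + y w) -
            max (coordinates_below r V x v) (coordinates_below r V y w))
     else 0)"

lemma coordinates_below_mono:
  assumes r: "linear_order_on V r" and V: "finite V" and x: "\<And>u. 0 \<le> x u"
    and v: "(v, v') \<in> r" "v \<noteq> v'"
  shows "coordinates_below r V x v + x v \<le> coordinates_below r V x v'"
proof -
  let ?B = "\<lambda>v. {u \<in> V. (u, v) \<in> r \<and> u \<noteq> v}"
  have r': "trans r" "antisym r" "r \<subseteq> V \<times> V"
    using r by (simp_all add: order_on_defs)
  have "coordinates_below r V x v + x v = sum x (insert v (?B v))"
    using V by (simp add: coordinates_below_def)
  also have "\<dots> \<le> sum x (?B v')"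
  proof (rule sum_mono2)
    show "insert v (?B v) \<subseteq> ?B v'"
      using v r'(3) transD[OF r'(1)] antisymD[OF r'(2)] by blast
  qed (use V x in auto)
  finally show ?thesis by (simp add: coordinates_below_def)
qed

lemma overlap_pos_iff:
  "0 < overlap r V x y (v, w) \<longleftrightarrow> v \<in> V \<and> w \<in> V \<and> 0 < x v \<and> 0 < y w \<and>
     coordinates_below r V x v < coordinates_below r V y w + y w \<and>
     coordinates_below r V y w < coordinates_below r V x v + x v"
  by (auto simp: overlap_def max_def min_def)

text \<open>If \<open>w\<close> came after \<open>w'\<close>, the interval of \<open>v\<close> would end before that of \<open>v'\<close> begins, while the
  interval of \<open>w\<close> begins only after that of \<open>w'\<close> has ended; then the two pairs could not both
  overlap.\<close>

lemma overlap_no_crossing: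
  assumes r: "linear_order_on V r" and V: "finite V" and xy: "\<And>u. 0 \<le> x u" "\<And>u. 0 \<le> y u"
    and pos: "0 < overlap r V x y (v, w)" "0 < overlap r V x y (v', w')"
    and v: "(v, v') \<in> r" "v \<noteq> v'"
  shows "(w, w') \<in> r"
proof (rule ccontr)
  assume nw: "(w, w') \<notin> r"
  have "w \<in> V" "w' \<in> V" using pos by (simp_all add: overlap_pos_iff)
  moreover have "refl_on V r" "total_on V r" using r by (simp_all add: order_on_defs)
  ultimately have w: "(w', w) \<in> r" "w' \<noteq> w"
    using nw by (metis refl_onD total_on_def)+
  show False
    using coordinates_below_mono[where x = x, OF r V xy(1) v]
      coordinates_below_mono[where x = y, OF r V xy(2) w] pos
    by (simp add: overlap_pos_iff)
qed

lemma first_vertex_exists: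
  assumes r: "linear_order_on V r" and S: "finite S" "S \<noteq> {}" "S \<subseteq> V"
  shows "\<exists>m\<in>S. \<forall>u\<in>S. (m, u) \<in> r"
proof -
  have r': "trans r" "refl_on V r" "total_on V r" using r by (simp_all add: order_on_defs)
  have "(u, v) \<in> r \<or> (v, u) \<in> r" if "u \<in> S" "v \<in> S" for u v
    using that S(3) r'(2,3) by (metis refl_onD subsetD total_on_def)
  then obtain ps where ps: "set ps = S" "sorted_wrt (\<lambda>u v. (u, v) \<in> r) ps"
    using sorted_list_of_chain[OF S(1) r'(1)] by blast
  obtain m qs where m: "ps = m # qs" using ps(1) S(2) by (cases ps) auto
  then have "m \<in> S" "\<forall>u\<in>S. (m, u) \<in> r"
    using ps S(3) refl_onD[OF r'(2), of m] by auto
  then show ?thesis by blast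
qed

lemma coordinates_below_first:
  assumes r: "linear_order_on V r" and m: "\<And>u. u \<in> support x \<Longrightarrow> (m, u) \<in> r"
  shows "coordinates_below r V x m = 0"
proof -
  have "antisym r" using r by (simp add: order_on_defs)
  then have "x u = 0" if "(u, m) \<in> r" "u \<noteq> m" for u
    using that m[of u] antisymD[of r m u] by (auto simp: support_def)
  then show ?thesis by (simp add: coordinates_below_def)
qed

text \<open>Scaled overlaps; the intervals of the first vertices of the two supports both start at zero, so
  that some overlap is positive.\<close>

lemma map_to_ordered_square_exists:
  assumes K: "abstract_complex K" "finite K" and r: "linear_order_on (\<Union>K) r"
  shows "\<exists>q. continuous_map (prod_topology (realization K) (realization K)) (realization (ordered_square r K)) q \<and>
    (\<forall>x\<in>topspace (realization K). \<forall>y\<in>topspace (realization K).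
       fst ` support (q (x, y)) \<subseteq> support x \<and> snd ` support (q (x, y)) \<subseteq> support y)"
proof -
  let ?V = "\<Union>K"
  let ?P = "prod_topology (realization K) (realization K)"
  have V: "finite ?V" using finite_vertices[OF K] .
  have r': "trans r" "refl_on ?V r" "total_on ?V r" using r by (simp_all add: order_on_defs)
  define f where "f p = overlap r ?V (fst p) (snd p)" for p
  have f_nonneg: "0 \<le> f p z" for p z by (simp add: f_def overlap_def case_prod_beta)
  then have f_supp: "z \<in> support (f p) \<longleftrightarrow> 0 < f p z" for p z
    by (simp add: support_def less_le)
  have supp: "fst z \<in> support x \<and> snd z \<in> support y" if "z \<in> support (f (x, y))" for x y z
    using that unfolding f_supp by (cases z) (auto simp: f_def overlap_pos_iff support_def)
  have suppV: "support (f p) \<subseteq> ?V \<times> ?V" for p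
    unfolding f_supp subset_iff by (auto simp: f_def overlap_pos_iff)
  have suppK: "support (f (x, y)) \<in> ordered_square r K"
    if x: "x \<in> topspace (realization K)" and y: "y \<in> topspace (realization K)" for x y
  proof -
    note nn = realization_memberD(1)[OF x] realization_memberD(1)[OF y]
    have sx: "support x \<in> K" and sy: "support y \<in> K" using realization_memberD(2) x y by blast+
    have first: "\<exists>m\<in>support z. coordinates_below r ?V z m = 0"
      if "support z \<in> K" for z :: "'a \<Rightarrow> real"
      using first_vertex_exists[OF r complex_simplexD(1,2)[OF K(1) that]] coordinates_below_first[OF r] that
      by (metis Union_upper)
    obtain v w where vw: "v \<in> support x" "coordinates_below r ?V x v = 0"
      "w \<in> support y" "coordinates_below r ?V y w = 0"
      using first[OF sx] first[OF sy] by blast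
    then have "(v, w) \<in> support (f (x, y))"
      unfolding f_supp using sx sy coordinate_pos_iff[OF x] coordinate_pos_iff[OF y]
      by (auto simp: f_def overlap_pos_iff)
    then have ne: "support (f (x, y)) \<noteq> {}" by blast
    show ?thesis
    proof (rule ordered_squareI[OF K(1) r'(1) ne])
      show "finite (support (f (x, y)))" using suppV V by (meson finite_SigmaI finite_subset)
      show "fst ` support (f (x, y)) \<in> K" "snd ` support (f (x, y)) \<in> K"
        using ne supp by (intro complex_simplexD(3)[OF K(1) sx] complex_simplexD(3)[OF K(1) sy]
            image_subsetI; force)+
      fix p q assume pq: "p \<in> support (f (x, y))" "q \<in> support (f (x, y))"
      obtain v w v' w' where vw: "p = (v, w)" "q = (v', w')" by fastforce
      have pos: "0 < overlap r ?V x y (v, w)" "0 < overlap r ?V x y (v', w')"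
        using pq unfolding f_supp by (simp_all add: f_def vw)
      then have mem: "v \<in> ?V" "v' \<in> ?V" "w \<in> ?V" "w' \<in> ?V" unfolding overlap_pos_iff by blast+
      note nc = overlap_no_crossing[OF r V nn]
      consider "v = v'" | "(v, v') \<in> r" "v \<noteq> v'" | "(v', v) \<in> r" "v' \<noteq> v"
        using r'(3) mem by (metis total_on_def)
      then show "(fst p, fst q) \<in> r \<and> (snd p, snd q) \<in> r \<or> (fst q, fst p) \<in> r \<and> (snd q, snd p) \<in> r"
      proof cases
        case 1
        then show ?thesis using mem r'(2,3) unfolding vw by (metis fst_conv snd_conv refl_onD total_on_def)
      next
        case 2
        then show ?thesis using nc[OF pos 2] by (simp add: vw)
      next
        case 3
        then show ?thesis using nc[OF pos(2,1) 3] by (simp add: vw)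
      qed
    qed
  qed
  have "continuous_map ?P (realization (ordered_square r K)) (\<lambda>p. normalize_on (?V \<times> ?V) (f p))"
  proof (rule continuous_map_normalize_on[OF abstract_complex_ordered_square[OF K(1)]])
    show "finite (?V \<times> ?V)" using V by simp
    have cont: "continuous_map ?P euclideanreal (\<lambda>p. fst p v)" "continuous_map ?P euclideanreal (\<lambda>p. snd p v)" for v
      using continuous_map_compose[OF continuous_map_fst continuous_map_realization_coordinate]
        continuous_map_compose[OF continuous_map_snd continuous_map_realization_coordinate]
      by (simp_all add: o_def)
    have fin: "finite {u \<in> ?V. (u, v) \<in> r \<and> u \<noteq> v}" for v
      by (rule finite_subset[OF _ V]) blast
    have cont_below: "continuous_map ?P euclideanreal (\<lambda>p. coordinates_below r ?V (fst p) v)"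
      "continuous_map ?P euclideanreal (\<lambda>p. coordinates_below r ?V (snd p) v)" for v
      unfolding coordinates_below_def by (intro continuous_map_sum cont fin)+
    show "continuous_map ?P euclideanreal (\<lambda>p. f p z)" for z
      unfolding f_def overlap_def case_prod_beta
      by (intro continuous_map_if continuous_intros cont cont_below)
    show "support (f p) \<in> ordered_square r K" if "p \<in> topspace ?P" for p
      using that suppK by auto
  qed (use f_nonneg suppV in auto)
  moreover have "support (normalize_on W (f p)) \<subseteq> support (f p)" for W p
    by (auto simp: support_def normalize_on_def)
  ultimately show ?thesis
    using supp by (intro exI[of _ "\<lambda>p. normalize_on (?V \<times> ?V) (f p)"]) fastforce
qed

text \<open>The maps between the product and the realization of the ordered square respect the two projections up
  to straight lines.\<close>

lemma homotopic_distance_square: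
  assumes K: "abstract_complex K" "finite K" and r: "linear_order_on (\<Union>K) r"
  shows "homotopic_distance (prod_topology (realization K) (realization K)) (realization K) fst snd =
    homotopic_distance (realization (ordered_square r K)) (realization K) (realization_map fst) (realization_map snd)"
    (is "?P = ?S")
proof (rule antisym)
  let ?X = "realization K"
  let ?XX = "prod_topology ?X ?X"
  let ?Q = "ordered_square r K"
  note Q = abstract_complex_ordered_square[OF K(1), of r] finite_ordered_square[OF K, of r]
  have proj: "continuous_map (realization ?Q) ?X (realization_map fst)"
    "continuous_map (realization ?Q) ?X (realization_map snd)"
    by (intro continuous_map_realization_map[OF Q]; simp add: simplicial_map_def ordered_square_projections)+
  obtain q where q: "continuous_map ?XX (realization ?Q) q"
    "\<forall>x\<in>topspace ?X. \<forall>y\<in>topspace ?X.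
       fst ` support (q (x, y)) \<subseteq> support x \<and> snd ` support (q (x, y)) \<subseteq> support y"
    using map_to_ordered_square_exists[OF K r] by (elim exE conjE)
  have qmem: "q p \<in> topspace (realization ?Q)" if "p \<in> topspace ?XX" for p
    using q(1) that unfolding continuous_map_into_realization by blast
  have supp: "support (realization_map fst (q p)) \<subseteq> support (fst p)"
    "support (realization_map snd (q p)) \<subseteq> support (snd p)" if p: "p \<in> topspace ?XX" for p
  proof -
    have "fst ` support (q p) \<subseteq> support (fst p) \<and> snd ` support (q p) \<subseteq> support (snd p)"
      using q(2)[rule_format, of "fst p" "snd p"] p by (simp add: mem_Times_iff)
    then show "support (realization_map fst (q p)) \<subseteq> support (fst p)"
      "support (realization_map snd (q p)) \<subseteq> support (snd p)"
      by (simp_all add: support_realization_map[OF Q(1) qmem[OF p]])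
  qed
  show "?P \<le> ?S"
  proof (rule homotopic_distance_pullback[OF q(1)])
    show "homotopic ?XX ?X (realization_map fst \<circ> q) fst"
      by (rule homotopic_if_support_subset[OF K(1) continuous_map_compose[OF q(1) proj(1)] continuous_map_fst])
        (use supp in simp)
    show "homotopic ?XX ?X (realization_map snd \<circ> q) snd"
      by (rule homotopic_if_support_subset[OF K(1) continuous_map_compose[OF q(1) proj(2)] continuous_map_snd])
        (use supp in simp)
  qed
  show "?S \<le> ?P"
  proof (rule homotopic_distance_pullback)
    show "continuous_map (realization ?Q) ?XX (\<lambda>z. (realization_map fst z, realization_map snd z))"
      using proj by (simp add: continuous_map_pairwise o_def)
  qed (use proj in \<open>simp_all add: o_def\<close>)
qed

section \<open>Category and topological complexity\<close>

lemma homotopic_distance_cong: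
  assumes "\<And>U. openin X U \<Longrightarrow>
    homotopic (subtopology X U) Y f g \<longleftrightarrow> homotopic (subtopology X U) Z f' g'"
  shows "homotopic_distance X Y f g = homotopic_distance X Z f' g'"
  unfolding homotopic_distance_def
  by (intro arg_cong[where f = "\<lambda>S. Inf S - 1"] Collect_cong ex_cong1 conj_cong refl ball_cong)
    (use assms in blast)

lemma homotopic_realization_map_id:
  assumes K: "abstract_complex K" "finite K"
  shows "homotopic (realization K) (realization K) (realization_map id) id"
  by (rule homotopic_if_support_subset[OF K(1) continuous_map_realization_map[OF K]])
    (simp_all add: simplicial_map_def support_realization_map[OF K(1)] id_def)

lemma homotopic_realization_map_const:
  assumes K: "abstract_complex K" "finite K" and v: "v \<in> \<Union>K"
  shows "homotopic (realization K) (realization K) (realization_map (\<lambda>_. v)) (\<lambda>_. vertex_point v)"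
proof (rule homotopic_if_support_subset[OF K(1)])
  have sv: "{v} \<in> K" using singleton_in_complex[OF K(1) v] .
  then show "continuous_map (realization K) (realization K) (realization_map (\<lambda>_. v))"
    using complex_simplexD(2)[OF K(1)]
    by (intro continuous_map_realization_map[OF K]) (auto simp: simplicial_map_def image_constant_conv)
  show "continuous_map (realization K) (realization K) (\<lambda>_. vertex_point v)"
    using vertex_point_in_realization[OF sv] by simp
qed (auto simp: support_realization_map[OF K(1)])

lemma LS_category_eq_homotopic_distance:
  assumes K: "abstract_complex K" "finite K" "connected_complex K" and v: "v \<in> \<Union>K"
  shows "LS_category (realization K) =
    homotopic_distance (realization K) (realization K) (realization_map (\<lambda>_. v)) (realization_map id)"
proof -
  let ?X = "realization K"
  have "null_homotopic_in ?X U \<longleftrightarrow>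
      homotopic (subtopology ?X U) ?X (realization_map (\<lambda>_. v)) (realization_map id)" for U
  proof -
    let ?U = "subtopology ?X U"
    have id: "homotopic ?U ?X (realization_map id) id"
      using homotopic_realization_map_id[OF K(1,2)] by (rule homotopic_from_subtopology)
    have const: "homotopic ?U ?X (realization_map (\<lambda>_. v)) (\<lambda>_. vertex_point v)"
      using homotopic_realization_map_const[OF K(1,2) v] by (rule homotopic_from_subtopology)
    have pt: "vertex_point v \<in> topspace ?X"
      by (rule vertex_point_in_realization) (rule singleton_in_complex[OF K(1) v])
    show ?thesis
    proof
      assume "null_homotopic_in ?X U"
      then obtain a where a: "a \<in> topspace ?X" "homotopic ?U ?X id (\<lambda>_. a)"
        unfolding null_homotopic_in_def by blast
      have "homotopic ?U ?X id (\<lambda>_. vertex_point v)"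
        using a(2) homotopic_constant_vertex_point[OF K(1,3) a(1) v] by (rule homotopic_with_trans)
      then show "homotopic ?U ?X (realization_map (\<lambda>_. v)) (realization_map id)"
        using id const by (meson homotopic_with_symD homotopic_with_trans)
    next
      assume "homotopic ?U ?X (realization_map (\<lambda>_. v)) (realization_map id)"
      then have "homotopic ?U ?X id (\<lambda>_. vertex_point v)"
        using id const by (meson homotopic_with_symD homotopic_with_trans)
      then show "null_homotopic_in ?X U" unfolding null_homotopic_in_def using pt by blast
    qed
  qed
  then show ?thesis unfolding LS_category_def homotopic_distance_def by simp
qed

lemma simplicial_axial_inclusions:
  assumes K: "abstract_complex K" and r: "linear_order_on (\<Union>K) r" and v: "v0 \<in> \<Union>K"
  shows "simplicial_map K (ordered_square r K) (\<lambda>v. (v, v0))"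
    and "simplicial_map K (ordered_square r K) (\<lambda>v. (v0, v))"
proof -
  have r': "trans r" "refl_on (\<Union>K) r" "total_on (\<Union>K) r" using r by (simp_all add: order_on_defs)
  have v0: "{v0} \<in> K" "(v0, v0) \<in> r"
    using singleton_in_complex[OF K v] refl_onD[OF r'(2) v] by simp_all
  have cmp: "(u, w) \<in> r \<or> (w, u) \<in> r" if "\<sigma> \<in> K" "u \<in> \<sigma>" "w \<in> \<sigma>" for \<sigma> u w
    using that r'(2,3) by (metis UnionI refl_onD total_on_def)
  show "simplicial_map K (ordered_square r K) (\<lambda>v. (v, v0))"
    unfolding simplicial_map_def
  proof
    fix \<sigma> assume \<sigma>: "\<sigma> \<in> K"
    show "(\<lambda>v. (v, v0)) ` \<sigma> \<in> ordered_square r K"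
    proof (rule ordered_squareI[OF K r'(1)])
      fix p q assume "p \<in> (\<lambda>v. (v, v0)) ` \<sigma>" "q \<in> (\<lambda>v. (v, v0)) ` \<sigma>"
      then obtain u w where "p = (\<lambda>v. (v, v0)) u" "q = (\<lambda>v. (v, v0)) w" "u \<in> \<sigma>" "w \<in> \<sigma>" by blast
      then show "(fst p, fst q) \<in> r \<and> (snd p, snd q) \<in> r \<or> (fst q, fst p) \<in> r \<and> (snd q, snd p) \<in> r"
        using cmp[OF \<sigma>, of u w] v0(2) by simp
    qed (use \<sigma> v0(1) complex_simplexD(1,2)[OF K \<sigma>] in \<open>auto simp: image_image image_constant_conv\<close>)
  qed
  show "simplicial_map K (ordered_square r K) (\<lambda>v. (v0, v))"
    unfolding simplicial_map_def
  proof
    fix \<sigma> assume \<sigma>: "\<sigma> \<in> K"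
    show "(\<lambda>v. (v0, v)) ` \<sigma> \<in> ordered_square r K"
    proof (rule ordered_squareI[OF K r'(1)])
      fix p q assume "p \<in> (\<lambda>v. (v0, v)) ` \<sigma>" "q \<in> (\<lambda>v. (v0, v)) ` \<sigma>"
      then obtain u w where "p = (\<lambda>v. (v0, v)) u" "q = (\<lambda>v. (v0, v)) w" "u \<in> \<sigma>" "w \<in> \<sigma>" by blast
      then show "(fst p, fst q) \<in> r \<and> (snd p, snd q) \<in> r \<or> (fst q, fst p) \<in> r \<and> (snd q, snd p) \<in> r"
        using cmp[OF \<sigma>, of u w] v0(2) by simp
    qed (use \<sigma> v0(1) complex_simplexD(1,2)[OF K \<sigma>] in \<open>auto simp: image_image image_constant_conv\<close>)
  qed
qed

lemma homotopic_realization_map_compose: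
  assumes K: "abstract_complex K" "finite K" and N: "abstract_complex N" "finite N"
    and M: "abstract_complex M" and \<phi>: "simplicial_map K N \<phi>" and \<psi>: "simplicial_map N M \<psi>"
  shows "homotopic (realization K) (realization M)
    (realization_map \<psi> \<circ> realization_map \<phi>) (realization_map (\<psi> \<circ> \<phi>))"
proof (rule homotopic_if_support_subset[OF M])
  note c = continuous_map_realization_map[OF K \<phi>]
  show "continuous_map (realization K) (realization M) (realization_map \<psi> \<circ> realization_map \<phi>)"
    by (rule continuous_map_compose[OF c continuous_map_realization_map[OF N \<psi>]])
  show "continuous_map (realization K) (realization M) (realization_map (\<psi> \<circ> \<phi>))"
    by (rule continuous_map_realization_map[OF K simplicial_map_compose[OF \<phi> \<psi>]])
  fix x assume x: "x \<in> topspace (realization K)"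
  then have y: "realization_map \<phi> x \<in> topspace (realization N)"
    using c by (simp add: continuous_map_into_realization)
  show "support ((realization_map \<psi> \<circ> realization_map \<phi>) x) \<subseteq> support (realization_map (\<psi> \<circ> \<phi>) x)"
    by (simp add: support_realization_map[OF N(1) y] support_realization_map[OF K(1) x] image_comp)
qed

text \<open>Composing with an axial inclusion and with the second projection turns homotopies of either
  kind into homotopies of the other kind.\<close>

lemma homotopic_distance_axial_inclusions:
  assumes K: "abstract_complex K" "finite K" and r: "linear_order_on (\<Union>K) r" and v: "v0 \<in> \<Union>K"
  shows "homotopic_distance (realization K) (realization K) (realization_map (\<lambda>_. v0)) (realization_map id) =
    homotopic_distance (realization K) (realization (ordered_square r K))
      (realization_map (\<lambda>v. (v, v0))) (realization_map (\<lambda>v. (v0, v)))"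
proof (rule homotopic_distance_cong)
  let ?X = "realization K"
  let ?Q = "ordered_square r K"
  let ?Y = "realization ?Q"
  let ?i = "realization_map (\<lambda>v. (v, v0))" and ?j = "realization_map (\<lambda>v. (v0, v))"
  note Q = abstract_complex_ordered_square[OF K(1), of r] finite_ordered_square[OF K, of r]
  fix U
  let ?U = "subtopology ?X U"
  have const: "simplicial_map K K (\<lambda>_. v0)" and ident: "simplicial_map K K id"
    using singleton_in_complex[OF K(1) v] complex_simplexD(2)[OF K(1)]
    by (auto simp: simplicial_map_def image_constant_conv)
  have snd: "simplicial_map ?Q K snd"
    by (simp add: simplicial_map_def ordered_square_projections)
  note ij = simplicial_axial_inclusions[OF K(1) r v]
  note comp = homotopic_from_subtopology[OF homotopic_realization_map_compose, where S = U]
  show "homotopic ?U ?X (realization_map (\<lambda>_. v0)) (realization_map id) \<longleftrightarrow> homotopic ?U ?Y ?i ?j"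
  proof
    assume hom: "homotopic ?U ?X (realization_map (\<lambda>_. v0)) (realization_map id)"
    have i: "homotopic ?U ?Y (?i \<circ> realization_map (\<lambda>_. v0)) (?i \<circ> realization_map id)"
      by (rule homotopic_with_compose_continuous_map_left[OF hom continuous_map_realization_map[OF K ij(1)]]) simp
    have j: "homotopic ?U ?Y (?j \<circ> realization_map (\<lambda>_. v0)) (?j \<circ> realization_map id)"
      by (rule homotopic_with_compose_continuous_map_left[OF hom continuous_map_realization_map[OF K ij(2)]]) simp
    have "homotopic ?U ?Y (?i \<circ> realization_map (\<lambda>_. v0)) ?i"
      using homotopic_with_trans[OF i comp[OF K K Q(1) ident ij(1)]] by (simp add: o_def id_def)
    moreover have "homotopic ?U ?Y (?j \<circ> realization_map (\<lambda>_. v0)) ?j"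
      using homotopic_with_trans[OF j comp[OF K K Q(1) ident ij(2)]] by (simp add: o_def id_def)
    moreover have "homotopic ?U ?Y (?i \<circ> realization_map (\<lambda>_. v0)) (?j \<circ> realization_map (\<lambda>_. v0))"
    proof -
      have "(\<lambda>v. (v, v0)) \<circ> (\<lambda>_. v0) = (\<lambda>v. (v0, v)) \<circ> (\<lambda>_::'a. v0)" by auto
      then show ?thesis
        using homotopic_with_trans[OF comp[OF K K Q(1) const ij(1)]]
          homotopic_with_symD[OF comp[OF K K Q(1) const ij(2)]] by simp
    qed
    ultimately show "homotopic ?U ?Y ?i ?j"
      by (meson homotopic_with_symD homotopic_with_trans)
  next
    assume hom: "homotopic ?U ?Y ?i ?j"
    have "homotopic ?U ?X (realization_map snd \<circ> ?i) (realization_map snd \<circ> ?j)"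
      by (rule homotopic_with_compose_continuous_map_left[OF hom continuous_map_realization_map[OF Q snd]]) simp
    moreover have "homotopic ?U ?X (realization_map snd \<circ> ?i) (realization_map (\<lambda>_. v0))"
      using comp[OF K Q K(1) ij(1) snd] by (simp add: o_def)
    moreover have "homotopic ?U ?X (realization_map snd \<circ> ?j) (realization_map id)"
      using comp[OF K Q K(1) ij(2) snd] by (simp add: o_def id_def)
    ultimately show "homotopic ?U ?X (realization_map (\<lambda>_. v0)) (realization_map id)"
      by (meson homotopic_with_symD homotopic_with_trans)
  qed
qed

theorem corollary3p7:
  fixes K :: "'a set set" and r :: "'a rel" and v0 :: 'a
    and lam :: "nat \<Rightarrow> 'a sd_vertex \<Rightarrow> 'a sd_vertex"
    and mu :: "nat \<Rightarrow> ('a \<times> 'a) sd_vertex \<Rightarrow> ('a \<times> 'a) sd_vertex"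
  assumes "abstract_complex K" and "finite K" and "connected_complex K"
    and "linear_order_on (\<Union>K) r"
    and "v0 \<in> \<Union>K"
    and "identity_approximations K lam"
    and "identity_approximations (ordered_square r K) mu"
  shows "LS_category (realization K) = contiguity_distance lam K K (\<lambda>_. v0) id \<and>
    contiguity_distance lam K K (\<lambda>_. v0) id =
      contiguity_distance lam K (ordered_square r K) (\<lambda>v. (v, v0)) (\<lambda>v. (v0, v)) \<and>
    topological_complexity (realization K) =
      contiguity_distance mu (ordered_square r K) K fst snd"
proof (intro conjI)
  note K = assms(1,2)
  note Q = abstract_complex_ordered_square[OF K(1), of r] finite_ordered_square[OF K, of r]
  have maps: "simplicial_map K K (\<lambda>_. v0)" "simplicial_map K K id"
    "simplicial_map (ordered_square r K) K fst" "simplicial_map (ordered_square r K) K snd"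
    using singleton_in_complex[OF K(1) assms(5)] complex_simplexD(2)[OF K(1)]
    by (auto simp: simplicial_map_def image_constant_conv ordered_square_projections)
  have cat: "contiguity_distance lam K K (\<lambda>_. v0) id = homotopic_distance (realization K) (realization K)
      (realization_map (\<lambda>_. v0)) (realization_map id)"
    by (rule contiguity_distance_eq_homotopic_distance[OF K K(1) assms(6) maps(1,2)])
  show "LS_category (realization K) = contiguity_distance lam K K (\<lambda>_. v0) id"
    using LS_category_eq_homotopic_distance[OF K assms(3,5)] cat by simp
  show "contiguity_distance lam K K (\<lambda>_. v0) id =
      contiguity_distance lam K (ordered_square r K) (\<lambda>v. (v, v0)) (\<lambda>v. (v0, v))"
    unfolding cat homotopic_distance_axial_inclusions[OF K assms(4,5)]
    by (rule contiguity_distance_eq_homotopic_distance[symmetric, OF K Q(1) assms(6)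
        simplicial_axial_inclusions[OF K(1) assms(4,5)]])
  show "topological_complexity (realization K) = contiguity_distance mu (ordered_square r K) K fst snd"
    unfolding topological_complexity_eq_homotopic_distance homotopic_distance_square[OF K assms(4)]
    by (rule contiguity_distance_eq_homotopic_distance[symmetric, OF Q K(1) assms(7) maps(3,4)])
qed

end
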